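(* Let $C_{-1}:=\{f\in L^2(\mu): f\ge -1\}$. Then $$\{A\in\mathrm{Aff}_{\mathbb{R}}(L^2(\mu)):\ AC_{-1}=C_{-1}\}=\{(\sqrt{S'}-1,\,U_S):\ S\in\mathrm{Aut}_2(X,\mathcal{A},\mu)\}.$$
   Context: $(X,\mathcal{A},\mu)$ is a standard $\sigma$-finite non-atomic measure space. $\mathrm{Aut}(X,\mathcal A,\mu)$ is the group of invertible nonsingular transformations; for $S$ in it, $S':=\frac{d\mu\circ S^{-1}}{d\mu}$ and $U_S f:=\sqrt{S'}\,f\circ S^{-1}$ (a unitary on $L^2(\mu)$). $\mathrm{Aut}_2(X,\mathcal{A},\mu):=\{S\in\mathrm{Aut}(X,\mathcal A,\mu):\ \sqrt{S'}-1\in L^2(\mu)\}$. $\mathcal{U}_{\mathbb{R}}(L^2(\mu))$ denotes unitaries of $L^2(\mu)$ preserving the real subspace $L^2_{\mathbb{R}}(\mu)$, and $\mathrm{Aff}_{\mathbb{R}}(L^2(\mu)):=L^2_{\mathbb{R}}(\mu)\rtimes\mathcal{U}_{\mathbb{R}}(L^2(\mu))$, where $A=(f,V)$ acts by $Ah=f+Vh$ and $(f,V)(f',V')=(f+Vf',VV')$. *)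

theory Defs
  imports "HOL-Analysis.Analysis" "HOL-Probability.Probability"
begin

definition standard_borel :: "'a measure \<Rightarrow> bool" where
  "standard_borel M \<longleftrightarrow>
     (\<exists>T :: 'a topology. completely_metrizable_space T \<and> separable_space T \<and>
        topspace T = space M \<and> sets M = sigma_sets (space M) {U. openin T U})"

definition non_atomic :: "'a measure \<Rightarrow> bool" where
  "non_atomic M \<longleftrightarrow>
     (\<forall>A\<in>sets M. 0 < emeasure M A \<longrightarrow>
        (\<exists>B\<in>sets M. B \<subseteq> A \<and> 0 < emeasure M B \<and> emeasure M B < emeasure M A))"

definition standard_sf_na :: "'a measure \<Rightarrow> bool" where
  "standard_sf_na M \<longleftrightarrow> standard_borel M \<and> sigma_finite_measure M \<and> non_atomic M"

section \<open>L^2 (complex), represented by functions; equality is a.e. equality\<close>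

definition L2 :: "'a measure \<Rightarrow> ('a \<Rightarrow> complex) set" where
  "L2 M = {f. f \<in> borel_measurable M \<and> integrable M (\<lambda>x. (cmod (f x))\<^sup>2)}"

definition ae_eq :: "'a measure \<Rightarrow> ('a \<Rightarrow> complex) \<Rightarrow> ('a \<Rightarrow> complex) \<Rightarrow> bool" where
  "ae_eq M f g \<longleftrightarrow> (AE x in M. f x = g x)"

definition L2R :: "'a measure \<Rightarrow> ('a \<Rightarrow> complex) set" where
  "L2R M = {f \<in> L2 M. AE x in M. f x \<in> \<real>}"

definition l2_inner :: "'a measure \<Rightarrow> ('a \<Rightarrow> complex) \<Rightarrow> ('a \<Rightarrow> complex) \<Rightarrow> complex" where
  "l2_inner M f g = (\<integral>x. cnj (f x) * g x \<partial>M)"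

definition unitary_L2 :: "'a measure \<Rightarrow> (('a \<Rightarrow> complex) \<Rightarrow> ('a \<Rightarrow> complex)) \<Rightarrow> bool" where
  "unitary_L2 M V \<longleftrightarrow>
     (\<forall>f\<in>L2 M. V f \<in> L2 M) \<and>
     (\<forall>f\<in>L2 M. \<forall>g\<in>L2 M. ae_eq M f g \<longrightarrow> ae_eq M (V f) (V g)) \<and>
     (\<forall>f\<in>L2 M. \<forall>g\<in>L2 M. ae_eq M (V (\<lambda>x. f x + g x)) (\<lambda>x. V f x + V g x)) \<and>
     (\<forall>f\<in>L2 M. \<forall>c. ae_eq M (V (\<lambda>x. c * f x)) (\<lambda>x. c * V f x)) \<and>
     (\<forall>f\<in>L2 M. \<forall>g\<in>L2 M. l2_inner M (V f) (V g) = l2_inner M f g) \<and>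
     (\<forall>g\<in>L2 M. \<exists>f\<in>L2 M. ae_eq M (V f) g)"

definition unitary_R :: "'a measure \<Rightarrow> (('a \<Rightarrow> complex) \<Rightarrow> ('a \<Rightarrow> complex)) \<Rightarrow> bool" where
  "unitary_R M V \<longleftrightarrow> unitary_L2 M V \<and>
     (\<forall>f\<in>L2R M. V f \<in> L2R M) \<and> (\<forall>g\<in>L2R M. \<exists>f\<in>L2R M. ae_eq M (V f) g)"

text \<open>Aff_R(L^2) = L2_R \<rtimes> U_R; A = (f, V) acts by h \<mapsto> f + V h.\<close>
definition Aff_R :: "'a measure \<Rightarrow> (('a \<Rightarrow> complex) \<times> (('a \<Rightarrow> complex) \<Rightarrow> ('a \<Rightarrow> complex))) set" where
  "Aff_R M = {(f, V). f \<in> L2R M \<and> unitary_R M V}"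

definition aff_apply ::
  "(('a \<Rightarrow> complex) \<times> (('a \<Rightarrow> complex) \<Rightarrow> ('a \<Rightarrow> complex))) \<Rightarrow> ('a \<Rightarrow> complex) \<Rightarrow> ('a \<Rightarrow> complex)" where
  "aff_apply A h = (\<lambda>x. fst A x + snd A h x)"

definition C_minus1 :: "'a measure \<Rightarrow> ('a \<Rightarrow> complex) set" where
  "C_minus1 M = {f \<in> L2 M. AE x in M. f x \<in> \<real> \<and> Re (f x) \<ge> -1}"

text \<open>A C = C, modulo a.e. equality (C is closed under a.e. equality).\<close>
definition aff_preserves ::
  "'a measure \<Rightarrow> (('a \<Rightarrow> complex) \<times> (('a \<Rightarrow> complex) \<Rightarrow> ('a \<Rightarrow> complex))) \<Rightarrow> ('a \<Rightarrow> complex) set \<Rightarrow> bool" where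
  "aff_preserves M A C \<longleftrightarrow>
     (\<forall>h\<in>C. aff_apply A h \<in> C) \<and> (\<forall>g\<in>C. \<exists>h\<in>C. ae_eq M (aff_apply A h) g)"

definition nonsingular_aut :: "'a measure \<Rightarrow> ('a \<Rightarrow> 'a) \<Rightarrow> bool" where
  "nonsingular_aut M S \<longleftrightarrow>
     bij_betw S (space M) (space M) \<and> S \<in> M \<rightarrow>\<^sub>M M \<and> inv_into (space M) S \<in> M \<rightarrow>\<^sub>M M \<and>
     (\<forall>A\<in>sets M. emeasure M (S -` A \<inter> space M) = 0 \<longleftrightarrow> emeasure M A = 0)"

definition Sprime :: "'a measure \<Rightarrow> ('a \<Rightarrow> 'a) \<Rightarrow> 'a \<Rightarrow> real" where
  "Sprime M S x = enn2real (RN_deriv M (distr M M S) x)"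

definition U_op :: "'a measure \<Rightarrow> ('a \<Rightarrow> 'a) \<Rightarrow> ('a \<Rightarrow> complex) \<Rightarrow> ('a \<Rightarrow> complex)" where
  "U_op M S f = (\<lambda>x. complex_of_real (sqrt (Sprime M S x)) * f (inv_into (space M) S x))"

definition sqrtSp_m1 :: "'a measure \<Rightarrow> ('a \<Rightarrow> 'a) \<Rightarrow> ('a \<Rightarrow> complex)" where
  "sqrtSp_m1 M S = (\<lambda>x. complex_of_real (sqrt (Sprime M S x) - 1))"

definition Aut2 :: "'a measure \<Rightarrow> ('a \<Rightarrow> 'a) set" where
  "Aut2 M = {S. nonsingular_aut M S \<and> sqrtSp_m1 M S \<in> L2 M}"

end

theory Submission
  imports Defs
begin

text \<open>
  If \<open>A = (f, V)\<close> preserves \<open>C\<^sub>-\<^sub>1\<close>, then applying \<open>A\<close> and its inverse to \<open>n h\<close> and letting \<open>n\<close> grow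
  shows that \<open>V\<close> preserves positivity in both directions. Orthogonal nonnegative functions have
  disjoint supports, so for a strictly positive weight \<open>w\<close> in \<open>L\<^sup>2\<close> and \<open>v = V w\<close> the equation
  \<open>V (w 1\<^sub>E) = v 1\<^sub>F\<close> is an isomorphism \<open>E \<mapsto> F\<close> of the measure algebra. On a standard Borel
  space it is induced by point maps \<open>T\<close>, \<open>T'\<close> that are inverse to each other almost everywhere. A
  Borel copy of the whole space inside a null set (this uses that the measure has no atoms) allows
  one to correct \<open>T\<close> on a null set by a Schroeder-Bernstein argument to a bijection \<open>S\<^sup>-\<^sup>1\<close>.
  Unitarity forces \<open>v\<close> to be \<open>U\<^sub>S w\<close> and hence \<open>V = U\<^sub>S\<close>.
\<close>

section \<open>Standard Borel spaces as retracts of the Cantor space\<close>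

text \<open>Two point maps that are inverse almost everywhere do not suffice:
  \<open>nonsingular_aut\<close> asks for a bijection of the whole space, measurable in both
  directions. The null sets left over on the two sides may differ in cardinality, one empty and the
  other uncountable, so they cannot simply be matched; each is absorbed into an uncountable null set
  instead. Every injection used for this carries an everywhere defined measurable left inverse. Then
  images of measurable sets are solution sets of equations between measurable maps, and no theorem
  on injective Borel images enters. This is also why the space is coded as a retract of the Cantor
  space and not merely embedded in it. Constants lie outside \<open>L2 M\<close> when the measure is
  infinite; the weight \<open>w\<close> and the functions \<open>- 1_E\<close> with \<open>E\<close>
  of finite measure stand in for 1 and -1. The zero measure is treated apart, since a null copy is
  built inside a set of positive measure; there the identity serves.\<close>

definition cantor :: "(nat \<Rightarrow> bool) measure" where
  "cantor = Pi\<^sub>M UNIV (\<lambda>_. count_space UNIV)"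

lemma space_cantor [simp]: "space cantor = UNIV"
  by (simp add: cantor_def space_PiM)

lemma measurable_cantor_nth [measurable]: "(\<lambda>y. y n) \<in> cantor \<rightarrow>\<^sub>M count_space UNIV"
  unfolding cantor_def by (rule measurable_component_singleton) simp

lemma measurable_cantorI:
  assumes "\<And>n. Measurable.pred M (\<lambda>x. f x n)"
  shows "f \<in> M \<rightarrow>\<^sub>M cantor"
proof -
  have "(\<lambda>x n. f x n) \<in> M \<rightarrow>\<^sub>M cantor"
    unfolding cantor_def using assms by (intro measurable_PiM_single') auto
  then show ?thesis by simp
qed

lemma sets_cantor: "sets cantor = sigma_sets UNIV (range (\<lambda>n. {y. y n}))"
proof
  let ?G = "sigma UNIV (range (\<lambda>n. {y :: nat \<Rightarrow> bool. y n}))"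
  have "(\<lambda>y. y) \<in> ?G \<rightarrow>\<^sub>M cantor"
  proof (rule measurable_cantorI)
    fix n
    have "{y. y n} \<in> sets ?G" by (auto intro: sigma_sets.Basic)
    then show "Measurable.pred ?G (\<lambda>y. y n)" by (simp add: pred_def)
  qed
  from measurable_sets[OF this] show "sets cantor \<subseteq> sigma_sets UNIV (range (\<lambda>n. {y. y n}))"
    by auto
next
  have "{y. y n} \<in> sets cantor" for n
    using measurable_cantor_nth[of n] unfolding pred_def by simp
  then have "range (\<lambda>n. {y. y n}) \<subseteq> sets cantor" by blast
  then show "sigma_sets UNIV (range (\<lambda>n. {y. y n})) \<subseteq> sets cantor"
    using sets.sigma_sets_subset[of _ cantor] by auto
qed

text \<open>Bit \<open>(n, k)\<close> of \<open>e x\<close> records whether \<open>x\<close> lies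
  within \<open>1 / Suc k\<close> of the \<open>n\<close>-th dense point. From the bits one reads
  off a sequence of dense points converging to \<open>x\<close>, and \<open>r\<close> takes its
  limit.\<close>

lemma standard_borel_retract:
  assumes "standard_borel M" "space M \<noteq> {}"
  obtains e r where "e \<in> M \<rightarrow>\<^sub>M cantor" "r \<in> cantor \<rightarrow>\<^sub>M M" "\<And>x. x \<in> space M \<Longrightarrow> r (e x) = x"
proof -
  obtain T where T: "completely_metrizable_space T" "separable_space T" "topspace T = space M"
      "sets M = sigma_sets (space M) {U. openin T U}"
    using assms(1) unfolding standard_borel_def by blast
  obtain X d where X: "Metric_space X d" "Metric_space.mcomplete X d" "T = Metric_space.mtopology X d"
    using T(1) unfolding completely_metrizable_space_def by blast
  interpret Metric_space X d by fact
  have XM: "X = space M" using X(3) T(3) by simp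
  obtain C where C: "countable C" "C \<subseteq> X" "mtopology closure_of C = X"
    using T(2) X(3) unfolding separable_space_def by auto
  have "C \<noteq> {}" using C(3) assms(2) XM by auto
  define s where "s = from_nat_into C"
  have rs: "range s = C"
    using range_from_nat_into[OF \<open>C \<noteq> {}\<close> C(1)] by (simp add: s_def)
  have sX [simp]: "s n \<in> X" for n using rs C(2) by blast
  have dense: "\<exists>n. d x (s n) < \<epsilon>" if "x \<in> X" "\<epsilon> > 0" for x \<epsilon>
  proof -
    from that C(3) obtain y where "y \<in> C" "y \<in> mball x \<epsilon>"
      unfolding metric_closure_of by blast
    then show ?thesis using rs by (metis in_mball rangeE)
  qed
  have openM: "U \<in> sets M" if "openin T U" for U
    using that T(4) by auto
  have ball [measurable]: "Measurable.pred M (\<lambda>x. d x (s n) < q)" for n q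
  proof -
    have "{x \<in> space M. d x (s n) < q} = mball (s n) q"
      unfolding XM[symmetric] by (auto simp: commute)
    then show ?thesis using openM[of "mball (s n) q"] X(3) by (simp add: pred_def)
  qed
  \<comment> \<open>If no bit \<open>(n, k)\<close> of \<open>y\<close> is set, \<open>LEAST\<close>
    still denotes some index, so \<open>p y k\<close> is a dense point in every case.\<close>
  define p where "p y k = s (LEAST n. y (prod_encode (n, k)))" for y k
  define e where "e x m = (case prod_decode m of (n, k) \<Rightarrow> d x (s n) < 1 / Suc k)" for x m
  \<comment> \<open>Bit sequences whose dense points are not Cauchy code no point; the value
    \<open>s 0\<close> makes \<open>r\<close> total.\<close>
  define r where "r y = (if MCauchy (p y) then SOME x. limitin mtopology (p y) x sequentially else s 0)" for y
  have pX [simp]: "p y k \<in> X" for y k by (simp add: p_def)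
  have rlim: "limitin mtopology (p y) (r y) sequentially" if "MCauchy (p y)" for y
    using X(2) that unfolding mcomplete_def r_def by (auto intro: someI_ex)
  have rX: "r y \<in> X" for y
    using rlim[of y] limitin_mspace by (cases "MCauchy (p y)") (auto simp: r_def)
  have idx [measurable]: "(\<lambda>y. LEAST n. y (prod_encode (n, k))) \<in> cantor \<rightarrow>\<^sub>M count_space UNIV" for k
    by measurable
  have MC: "MCauchy (p y) \<longleftrightarrow> (\<forall>j. \<exists>N. \<forall>n n'. N \<le> n \<longrightarrow> N \<le> n' \<longrightarrow> d (p y n) (p y n') < 1 / Suc j)" for y
  proof
    assume *: "\<forall>j. \<exists>N. \<forall>n n'. N \<le> n \<longrightarrow> N \<le> n' \<longrightarrow> d (p y n) (p y n') < 1 / Suc j"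
    have "\<exists>N. \<forall>n n'. N \<le> n \<longrightarrow> N \<le> n' \<longrightarrow> d (p y n) (p y n') < \<epsilon>" if "\<epsilon> > 0" for \<epsilon>
    proof -
      obtain j where "1 / Suc j < \<epsilon>" using nat_approx_posE \<open>\<epsilon> > 0\<close> by blast
      then show ?thesis using * by (meson less_trans)
    qed
    then show "MCauchy (p y)" unfolding MCauchy_def by auto
  qed (auto simp: MCauchy_def)
  \<comment> \<open>The distance depends on \<open>y\<close> only through two natural numbers, so
    joint measurability of \<open>d\<close> is never at issue.\<close>
  have dpp [measurable]: "(\<lambda>y. d (p y n) (p y n')) \<in> borel_measurable cantor" for n n'
  proof -
    have "(\<lambda>y. (\<lambda>i j. d (s i) (s j)) (LEAST m. y (prod_encode (m, n))) (LEAST m. y (prod_encode (m, n'))))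
      \<in> borel_measurable cantor"
      by measurable
    then show ?thesis by (simp add: p_def)
  qed
  have dps [measurable]: "(\<lambda>y. d (p y n) (s i)) \<in> borel_measurable cantor" for n i
  proof -
    have "(\<lambda>y. (\<lambda>j. d (s j) (s i)) (LEAST m. y (prod_encode (m, n)))) \<in> borel_measurable cantor"
      by measurable
    then show ?thesis by (simp add: p_def)
  qed
  have [measurable]: "Measurable.pred cantor (\<lambda>y. MCauchy (p y))"
    unfolding MC by measurable
  \<comment> \<open>Distances from \<open>r y\<close> to the dense points are limits of measurable
    functions. They decide membership in an open set, which is a countable union of balls
    \<open>mball (s i) (1 / Suc k)\<close>.\<close>
  have drs: "d (r y) (s i) = (if MCauchy (p y) then lim (\<lambda>k. d (p y k) (s i)) else d (s 0) (s i))" for y i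
  proof (cases "MCauchy (p y)")
    case True
    have "(\<lambda>k. d (p y k) (s i)) \<longlonglongrightarrow> d (r y) (s i)"
    proof (rule LIMSEQ_I)
      fix \<epsilon> :: real assume "\<epsilon> > 0"
      then obtain N where N: "\<forall>n\<ge>N. d (p y n) (r y) < \<epsilon>"
        using rlim[OF True] unfolding limit_metric_sequentially by blast
      have "norm (d (p y n) (s i) - d (r y) (s i)) \<le> d (p y n) (r y)" for n
        using triangle[of "p y n" "r y" "s i"] triangle[of "r y" "p y n" "s i"] rX[of y]
        by (simp add: commute abs_le_iff)
      then show "\<exists>N. \<forall>n\<ge>N. norm (d (p y n) (s i) - d (r y) (s i)) < \<epsilon>"
        using N by (meson le_less_trans)
    qed
    then show ?thesis using True by (simp add: limI)
  qed (simp add: r_def)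
  have [measurable]: "(\<lambda>y. d (r y) (s i)) \<in> borel_measurable cantor" for i
    unfolding drs by measurable
  show ?thesis
  proof
    show "e \<in> M \<rightarrow>\<^sub>M cantor"
    proof (rule measurable_cantorI)
      fix m show "Measurable.pred M (\<lambda>x. e x m)"
        by (cases "prod_decode m") (simp add: e_def del: of_nat_Suc)
    qed
    show "r \<in> cantor \<rightarrow>\<^sub>M M"
    proof (rule measurable_sigma_sets[OF T(4)])
      show "{U. openin T U} \<subseteq> Pow (space M)" using T(3) openin_subset by auto
      show "r \<in> space cantor \<rightarrow> space M" using rX XM by simp
      fix U assume "U \<in> {U. openin T U}"
      then have U: "openin mtopology U" using X(3) by simp
      have "r y \<in> U \<longleftrightarrow> (\<exists>i k. mball (s i) (1 / Suc k) \<subseteq> U \<and> d (r y) (s i) < 1 / Suc k)" for y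
      proof
        assume "r y \<in> U"
        then obtain \<epsilon> where \<epsilon>: "\<epsilon> > 0" "mball (r y) \<epsilon> \<subseteq> U" using U openin_mtopology by metis
        then obtain k where k: "1 / Suc k < \<epsilon> / 2" using nat_approx_posE[of "\<epsilon> / 2"] by auto
        obtain i where i: "d (r y) (s i) < 1 / Suc k"
          using dense[OF rX, of "1 / Suc k" y] by auto
        have "mball (s i) (1 / Suc k) \<subseteq> mball (r y) \<epsilon>"
        proof
          fix z assume z: "z \<in> mball (s i) (1 / Suc k)"
          then have "d (r y) z \<le> d (r y) (s i) + d (s i) z" using triangle rX by auto
          then show "z \<in> mball (r y) \<epsilon>" using z i k rX by auto
        qed
        then show "\<exists>i k. mball (s i) (1 / Suc k) \<subseteq> U \<and> d (r y) (s i) < 1 / Suc k" using i \<epsilon> by blast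
      next
        assume "\<exists>i k. mball (s i) (1 / Suc k) \<subseteq> U \<and> d (r y) (s i) < 1 / Suc k"
        then show "r y \<in> U" using rX by (auto simp: commute)
      qed
      then have "r -` U \<inter> space cantor =
          {y \<in> space cantor. \<exists>i k. mball (s i) (1 / Suc k) \<subseteq> U \<and> d (r y) (s i) < 1 / Suc k}"
        by auto
      also have "\<dots> \<in> sets cantor" by measurable
      finally show "r -` U \<inter> space cantor \<in> sets cantor" .
    qed
    fix x assume "x \<in> space M"
    then have x: "x \<in> X" using XM by simp
    have near: "d (p (e x) k) x < 1 / Suc k" for k
    proof -
      obtain n where "d x (s n) < 1 / Suc k" using dense[OF x, of "1 / Suc k"] by auto
      then have "e x (prod_encode (n, k))" by (simp add: e_def)
      then have "e x (prod_encode (LEAST n. e x (prod_encode (n, k)), k))" by (rule LeastI)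
      then show ?thesis by (simp add: e_def p_def commute)
    qed
    have lim: "limitin mtopology (p (e x)) x sequentially"
      unfolding limit_metric_sequentially
    proof (intro conjI allI impI x)
      fix \<epsilon> :: real assume "\<epsilon> > 0"
      then obtain N where N: "1 / Suc N < \<epsilon>" using nat_approx_posE by blast
      have "d (p (e x) n) x < \<epsilon>" if "n \<ge> N" for n
      proof -
        have "1 / Suc n \<le> (1 / Suc N :: real)" using that by (simp add: frac_le)
        then show ?thesis using near[of n] N by linarith
      qed
      then show "\<exists>N. \<forall>n\<ge>N. p (e x) n \<in> X \<and> d (p (e x) n) x < \<epsilon>" by auto
    qed
    then have "MCauchy (p (e x))" by (rule convergent_imp_MCauchy[rotated]) auto
    from rlim[OF this] lim show "r (e x) = x"
      using limitin_metric_unique by force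
  qed
qed

text \<open>The code \<open>e\<close> is injective, so two values coincide exactly when countably
  many bits do.\<close>

lemma standard_borel_pred_eq:
  assumes "standard_borel M" and [measurable]: "f \<in> N \<rightarrow>\<^sub>M M" "g \<in> N \<rightarrow>\<^sub>M M"
  shows "Measurable.pred N (\<lambda>x. f x = g x)"
proof (cases "space M = {}")
  case True
  then have "space N = {}" using measurable_space[OF assms(2)] by auto
  then have "{x \<in> space N. f x = g x} = {}" by simp
  show ?thesis unfolding pred_def \<open>{x \<in> space N. f x = g x} = {}\<close> by (rule sets.empty_sets)
next
  case False
  obtain e r where e: "e \<in> M \<rightarrow>\<^sub>M cantor"
    and r: "r \<in> cantor \<rightarrow>\<^sub>M M" "\<And>x. x \<in> space M \<Longrightarrow> r (e x) = x"
    using standard_borel_retract[OF assms(1) False] by metis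
  have [measurable]: "(\<lambda>x. e x n) \<in> M \<rightarrow>\<^sub>M count_space UNIV" for n
    by (rule measurable_compose[OF e measurable_cantor_nth])
  have "Measurable.pred N (\<lambda>x. \<forall>n. e (f x) n = e (g x) n)" by measurable
  also have "(\<lambda>x. \<forall>n. e (f x) n = e (g x) n) = (\<lambda>x. e (f x) = e (g x))"
    by (auto simp: fun_eq_iff)
  also have "Measurable.pred N (\<lambda>x. e (f x) = e (g x)) \<longleftrightarrow> Measurable.pred N (\<lambda>x. f x = g x)"
    using r(2) measurable_space[OF assms(2)] measurable_space[OF assms(3)] 
    by (intro measurable_cong) metis
  finally show ?thesis .
qed

text \<open>A point \<open>y\<close> is in the image of \<open>f\<close> exactly when
  \<open>f (g y) = y\<close>, a measurable condition. This is the source of measurability for all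
  images in the sequel.\<close>

lemma sets_image_retract:
  assumes "standard_borel M" and [measurable]: "f \<in> N \<rightarrow>\<^sub>M M" "g \<in> M \<rightarrow>\<^sub>M N"
    and gf: "\<And>x. x \<in> space N \<Longrightarrow> g (f x) = x" and [measurable]: "E \<in> sets N"
  shows "f ` E \<in> sets M"
proof -
  have [measurable]: "Measurable.pred M (\<lambda>y. f (g y) = y)"
    using assms(1) by (rule standard_borel_pred_eq) measurable
  have "f ` E = {y \<in> space M. f (g y) = y \<and> g y \<in> E}"
    using sets.sets_into_space[OF assms(5)] gf measurable_space[OF assms(2)] by (force simp: image_iff)
  also have "\<dots> \<in> sets M" by measurable
  finally show ?thesis .
qed

text \<open>The digits of the code are 0 and 1 in base 3, so the remainder after any digit is at most half
  a unit of that digit and taking floors recovers the digit.\<close>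

definition ternary_code :: "(nat \<Rightarrow> bool) \<Rightarrow> real" where
  "ternary_code y = (\<Sum>n. of_bool (y n) / 3 ^ Suc n)"

definition ternary_decode :: "real \<Rightarrow> nat \<Rightarrow> bool" where
  "ternary_decode x n \<longleftrightarrow> \<lfloor>3 ^ Suc n * x\<rfloor> mod 3 = 1"

lemma measurable_ternary_decode [measurable]: "ternary_decode \<in> borel \<rightarrow>\<^sub>M cantor"
  by (rule measurable_cantorI) (unfold ternary_decode_def, measurable)

lemma measurable_ternary_code [measurable]: "ternary_code \<in> borel_measurable cantor"
proof -
  have "(\<lambda>y. \<Sum>n. of_bool (y n) / 3 ^ Suc n :: real) \<in> borel_measurable cantor"
    by measurable
  then show ?thesis by (simp add: ternary_code_def[abs_def])
qed

lemma sums_third_powers: "(\<lambda>n. 1 / 3 ^ Suc n :: real) sums (1 / 2)"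
  using sums_mult[OF geometric_sums[of "1 / 3 :: real"], of "1 / 3"] by (simp add: power_divide)

lemma summable_ternary_code: "summable (\<lambda>n. of_bool (y n) / 3 ^ Suc n :: real)"
  by (rule summable_comparison_test'[OF sums_summable[OF sums_third_powers], of 0]) auto

lemma ternary_code_bounds: "0 \<le> ternary_code y" "ternary_code y \<le> 1 / 2"
proof -
  show "0 \<le> ternary_code y" unfolding ternary_code_def
    by (rule suminf_nonneg[OF summable_ternary_code]) auto
  have "ternary_code y \<le> (\<Sum>n. 1 / 3 ^ Suc n)" unfolding ternary_code_def
    by (rule suminf_le[OF _ summable_ternary_code sums_summable[OF sums_third_powers]]) auto
  then show "ternary_code y \<le> 1 / 2" using sums_third_powers by (simp add: sums_iff)
qed

lemma ternary_code_shift: "3 * ternary_code y = of_bool (y 0) + ternary_code (\<lambda>n. y (Suc n))"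
proof -
  have "ternary_code y = (\<Sum>n. of_bool (y (Suc n)) / 3 ^ Suc (Suc n)) + of_bool (y 0) / 3"
    using suminf_split_head[OF summable_ternary_code[of y]] by (simp add: ternary_code_def del: power_Suc)
  also have "(\<Sum>n. of_bool (y (Suc n)) / 3 ^ Suc (Suc n)) = ternary_code (\<lambda>n. y (Suc n)) / (3 :: real)"
    unfolding ternary_code_def by (subst suminf_divide[OF summable_ternary_code, symmetric]) (simp add: mult.commute)
  finally show ?thesis by simp
qed

lemma ternary_decode_code [simp]: "ternary_decode (ternary_code y) = y"
proof
  fix n show "ternary_decode (ternary_code y) n = y n"
  proof (induction n arbitrary: y)
    case 0
    have "\<lfloor>3 * ternary_code y\<rfloor> = of_bool (y 0)"
      using ternary_code_bounds[of "\<lambda>n. y (Suc n)"] unfolding ternary_code_shift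
      by (intro floor_unique) auto
    then show ?case by (simp add: ternary_decode_def)
  next
    case (Suc n)
    \<comment> \<open>The leading digit contributes 0 or \<open>3 ^ Suc n\<close>, a multiple of 3,
      and disappears modulo 3.\<close>
    have "3 ^ Suc (Suc n) * ternary_code y =
        3 ^ Suc n * ternary_code (\<lambda>n. y (Suc n)) + of_int (3 ^ Suc n * of_bool (y 0))"
      using arg_cong[OF ternary_code_shift[of y], of "\<lambda>t. 3 ^ Suc n * t"] by (simp add: algebra_simps)
    then have "\<lfloor>3 ^ Suc (Suc n) * ternary_code y\<rfloor> =
        \<lfloor>3 ^ Suc n * ternary_code (\<lambda>n. y (Suc n))\<rfloor> + 3 * (3 ^ n * of_bool (y 0))"
      by (simp only: floor_add_int) simp
    then have "\<lfloor>3 ^ Suc (Suc n) * ternary_code y\<rfloor> mod 3 = \<lfloor>3 ^ Suc n * ternary_code (\<lambda>n. y (Suc n))\<rfloor> mod 3"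
      by (simp only: mod_mult_self2)
    then show ?case using Suc.IH[of "\<lambda>n. y (Suc n)"] by (simp only: ternary_decode_def)
  qed
qed

section \<open>Copies of the space inside null sets\<close>

text \<open>The equivalence is the Galois connection between a right-continuous monotone function
  and its generalized inverse. Without atoms the cdf is continuous, so it hits \<open>t\<close>
  exactly at the quantile and thereby undoes the quantile function.\<close>

lemma cdf_quantile:
  assumes "finite_borel_measure N" "\<And>x. measure N {x} = 0" "0 < t" "t < measure N UNIV"
  defines "q \<equiv> Inf {x. t \<le> cdf N x}"
  shows "cdf N q = t" "t \<le> cdf N x \<longleftrightarrow> q \<le> x"
proof -
  interpret finite_borel_measure N by fact
  interpret right_continuous_mono "cdf N" 0 "measure N UNIV"
    using cdf_lim_at_top cdf_lim_at_bot
    by unfold_locales (auto intro: cdf_is_right_cont cdf_nondecreasing monoI simp: borel_UNIV)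
  show *: "t \<le> cdf N x \<longleftrightarrow> q \<le> x" for x
    unfolding q_def by (rule pseudoinverse) (use assms in auto)
  \<comment> \<open>Left of \<open>q\<close> the cdf stays below \<open>t\<close> by the
    equivalence; continuity carries the bound to \<open>q\<close>.\<close>
  have "cdf N q \<le> t"
  proof (rule tendsto_le)
    have "isCont (cdf N) q" by (simp add: isCont_cdf assms)
    then show "(cdf N \<longlongrightarrow> cdf N q) (at_left q)"
      unfolding isCont_def by (rule filterlim_mono) (auto simp: at_within_le_at)
    show "eventually (\<lambda>x. cdf N x \<le> t) (at_left q)"
      using *  by (auto simp: eventually_at_filter intro!: always_eventually) (metis linorder_not_le nle_le)
  qed auto
  then show "cdf N q = t" using *[of q] by simp
qed

text \<open>Around a quantile outside \<open>F\<close> some interval would carry no mass, so the cdf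
  would reach \<open>t\<close> already to the left of it, against minimality. The argument works for
  each single \<open>t\<close>, with no exceptional set.\<close>

lemma quantile_in_closed:
  assumes "finite_borel_measure N" "\<And>x. measure N {x} = 0" "0 < t" "t < measure N UNIV"
    and "closed F" "measure N (- F) = 0"
  shows "Inf {x. t \<le> cdf N x} \<in> F"
proof (rule ccontr)
  interpret finite_borel_measure N by fact
  define q where "q = Inf {x. t \<le> cdf N x}"
  assume "Inf {x. t \<le> cdf N x} \<notin> F"
  then have "q \<in> - F" "open (- F)" using assms(5) by (auto simp: q_def)
  then obtain \<epsilon> where \<epsilon>: "\<epsilon> > 0" "ball q \<epsilon> \<subseteq> - F" unfolding open_contains_ball by blast
  have "{q - \<epsilon> / 2<..q} \<subseteq> - F" using \<epsilon> by (intro order_trans[OF _ \<epsilon>(2)]) (auto simp: dist_real_def)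
  then have "measure N {q - \<epsilon> / 2<..q} \<le> measure N (- F)"
    using assms(5) by (intro finite_measure_mono) (auto simp: M_is_borel)
  then have "cdf N q = cdf N (q - \<epsilon> / 2)"
    using cdf_diff_eq[of "q - \<epsilon> / 2" q] \<epsilon>(1) assms(6) measure_nonneg[of N "{q - \<epsilon> / 2<..q}"] by simp
  moreover have "cdf N q = t"
    unfolding q_def by (rule cdf_quantile(1)[OF assms(1-4)])
  ultimately have "t \<le> cdf N (q - \<epsilon> / 2)" by linarith
  then have "q \<le> q - \<epsilon> / 2"
    unfolding q_def by (rule cdf_quantile(2)[OF assms(1-4), THEN iffD1])
  then show False using \<epsilon>(1) by linarith
qed

lemma singleton_sets_cantor: "{s} \<in> sets cantor"
proof -
  have "{s} = {y \<in> space cantor. \<forall>n. y n = s n}" by auto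
  also have "\<dots> \<in> sets cantor" by measurable
  finally show ?thesis .
qed

lemma uncountable_cantor: "uncountable (UNIV :: (nat \<Rightarrow> bool) set)"
proof
  assume "countable (UNIV :: (nat \<Rightarrow> bool) set)"
  then have "range (from_nat_into (UNIV :: (nat \<Rightarrow> bool) set)) = UNIV"
    by (intro range_from_nat_into) auto
  then obtain m where "from_nat_into UNIV m = (\<lambda>n. \<not> from_nat_into UNIV n n)"
    by (metis UNIV_I rangeE)
  then show False by metis
qed

text \<open>By the Galois connection each sublevel set is an interval inside the open range of
  masses. The value 0 outside that range is a default that keeps the function total.\<close>

lemma measurable_quantile:
  assumes "finite_borel_measure N" "\<And>x. measure N {x} = 0"
  shows "(\<lambda>t. if 0 < t \<and> t < measure N UNIV then Inf {x. t \<le> cdf N x} else 0) \<in> borel_measurable borel"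
    (is "?q \<in> _")
proof (rule borel_measurableI_le)
  fix z
  have "?q t \<le> z \<longleftrightarrow> (if 0 < t \<and> t < measure N UNIV then t \<le> cdf N z else 0 \<le> z)" for t
    using cdf_quantile(2)[OF assms, where t = t and x = z] by (simp split: if_split)
  then have "{t \<in> space borel. ?q t \<le> z} =
      {t. if 0 < t \<and> t < measure N UNIV then t \<le> cdf N z else 0 \<le> z}"
    by (simp only: space_borel UNIV_I simp_thms)
  also have "\<dots> = {0<..<measure N UNIV} \<inter> {..cdf N z} \<union> (if 0 \<le> z then - {0<..<measure N UNIV} else {})"
    by auto
  also have "\<dots> \<in> sets borel" by auto
  finally show "{t \<in> space borel. ?q t \<le> z} \<in> sets borel" .
qed

lemma (in sigma_finite_measure) exists_subset_finite_positive:
  assumes "A \<in> sets M" "emeasure M A \<noteq> 0"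
  obtains B where "B \<in> sets M" "B \<subseteq> A" "emeasure M B \<noteq> 0" "emeasure M B < \<infinity>"
proof -
  obtain C :: "nat \<Rightarrow> 'a set" where C: "range C \<subseteq> sets M" "(\<Union>i. C i) = space M"
      "\<And>i. emeasure M (C i) \<noteq> \<infinity>"
    using sigma_finite by metis
  have "\<exists>i. emeasure M (A \<inter> C i) \<noteq> 0"
  proof (rule ccontr)
    assume "\<nexists>i. emeasure M (A \<inter> C i) \<noteq> 0"
    then have "(\<Union>i. A \<inter> C i) \<in> null_sets M"
      using assms(1) C(1) by (intro null_sets_UN) (auto simp: null_sets_def)
    moreover have "(\<Union>i. A \<inter> C i) = A"
      using C(2) sets.sets_into_space[OF assms(1)] by auto
    ultimately show False using assms(2) by auto
  qed
  then obtain i where i: "emeasure M (A \<inter> C i) \<noteq> 0" ..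
  have "emeasure M (A \<inter> C i) \<le> emeasure M (C i)" using C(1) by (intro emeasure_mono) auto
  also have "\<dots> < \<infinity>" using C(3)[of i] by (simp add: less_top)
  finally show ?thesis
    using that[of "A \<inter> C i"] i C(1) assms(1) by auto
qed

text \<open>The fibre has at most one point, so its only nonempty subset is itself, and no subset
  can have strictly smaller positive measure.\<close>

lemma non_atomic_singleton_preimage:
  assumes "non_atomic M" and [measurable]: "e \<in> borel_measurable M" and "inj_on e (space M)"
  shows "emeasure M (e -` {z :: real} \<inter> space M) = 0"
proof (rule ccontr)
  let ?E = "e -` {z} \<inter> space M"
  assume *: "emeasure M ?E \<noteq> 0"
  have "?E \<in> sets M" by measurable
  then obtain B where B: "B \<subseteq> ?E" "0 < emeasure M B" "emeasure M B < emeasure M ?E"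
    using assms(1) * unfolding non_atomic_def by (metis not_gr_zero)
  then obtain b where "b \<in> B" by fastforce
  then have "B = ?E" using B(1) assms(3) by (auto simp: inj_on_def)
  then show False using B(3) by simp
qed

text \<open>On a compact set \<open>F\<close> of positive measure (after transport to the reals) the quantile function maps
  into \<open>F\<close> everywhere, not just almost everywhere. Interleaving a code of \<open>x\<close> with a parameter \<open>s\<close>
  gives uncountably many disjoint copies of the space, so one of them is null.\<close>

lemma non_atomic_null_retract:
  assumes sb: "standard_borel M" and "sigma_finite_measure M" "non_atomic M"
    and pos: "emeasure M (space M) \<noteq> 0" and A: "A \<in> sets M" "AE x in M. x \<in> A"
  obtains i r where "i \<in> M \<rightarrow>\<^sub>M M" "r \<in> M \<rightarrow>\<^sub>M M" "\<And>x. x \<in> space M \<Longrightarrow> r (i x) = x"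
    "i ` space M \<subseteq> A" "i ` space M \<in> null_sets M"
proof -
  interpret sigma_finite_measure M by fact
  have "emeasure M A = emeasure M (space M)" using A by (intro emeasure_eq_AE) auto
  then obtain B where [measurable]: "B \<in> sets M" and B: "B \<subseteq> A" "emeasure M B \<noteq> 0" "emeasure M B < \<infinity>"
    using exists_subset_finite_positive[OF A(1)] pos by metis
  have "space M \<noteq> {}" using pos by auto
  then obtain e0 r0 where e0 [measurable]: "e0 \<in> M \<rightarrow>\<^sub>M cantor" and r0 [measurable]: "r0 \<in> cantor \<rightarrow>\<^sub>M M"
    and r0e0: "\<And>x. x \<in> space M \<Longrightarrow> r0 (e0 x) = x"
    using standard_borel_retract[OF sb] by metis
  define e where "e x = ternary_code (e0 x)" for x
  define r where "r z = r0 (ternary_decode z)" for z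
  have e [measurable]: "e \<in> borel_measurable M" unfolding e_def[abs_def] by measurable
  have r [measurable]: "r \<in> borel \<rightarrow>\<^sub>M M" unfolding r_def[abs_def] by measurable
  have re: "r (e x) = x" if "x \<in> space M" for x using r0e0[OF that] by (simp add: r_def e_def)
  have atomless: "emeasure M (e -` {z} \<inter> space M) = 0" for z
    using re by (intro non_atomic_singleton_preimage assms inj_on_inverseI e)
  define \<nu> where "\<nu> S = distr (density M (indicator S)) borel e" for S
  have sets_\<nu> [simp]: "sets (\<nu> S) = sets borel" "space (\<nu> S) = UNIV" for S by (simp_all add: \<nu>_def)
  have em: "emeasure (\<nu> S) D = emeasure M (S \<inter> (e -` D \<inter> space M))" if "S \<in> sets M" "D \<in> sets borel" for S D
    using that by (simp add: \<nu>_def emeasure_distr emeasure_restricted)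
  have fin: "finite_borel_measure (\<nu> S)" if "S \<in> sets M" "S \<subseteq> B" for S
  proof -
    have "emeasure (\<nu> S) UNIV \<le> emeasure M B" using that em[of S UNIV] by (auto intro: emeasure_mono)
    then have "finite_measure (\<nu> S)" using B(3) by (intro finite_measureI) (auto simp: top_unique)
    then show ?thesis by (intro finite_borel_measure.intro finite_borel_measure_axioms.intro) auto
  qed
  \<comment> \<open>These are the codes of points of \<open>B\<close>; the equation
    \<open>e (r z) = z\<close> singles out the image of \<open>e\<close> as a Borel set.\<close>
  define K where "K = {z \<in> space borel. e (r z) = z \<and> r z \<in> B}"
  have [measurable]: "K \<in> sets borel" unfolding K_def by measurable
  have "B \<inter> (e -` K \<inter> space M) = B" using re sets.sets_into_space[of B M] by (auto simp: K_def)
  then have "emeasure (\<nu> B) K \<noteq> 0" using B(2) by (simp add: em)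
  \<comment> \<open>Inner regularity supplies a compact part of \<open>K\<close>. Closedness is what
    keeps every quantile inside it, and so keeps \<open>i\<close> below inside
    \<open>B\<close>.\<close>
  moreover have "emeasure (\<nu> B) K = (SUP F \<in> {F. F \<subseteq> K \<and> compact F}. emeasure (\<nu> B) F)"
  proof (rule inner_regular)
    interpret finite_borel_measure "\<nu> B" by (rule fin) auto
    show "emeasure (\<nu> B) (space (\<nu> B)) \<noteq> \<infinity>" using emeasure_finite by simp
  qed auto
  ultimately obtain F where F: "F \<subseteq> K" "compact F" "emeasure (\<nu> B) F \<noteq> 0"
    by (metis (mono_tags, lifting) SUP_bot_conv(2) bot_ennreal mem_Collect_eq)
  have [measurable]: "F \<in> sets borel" using F(2) by (simp add: borel_compact)
  define B' where "B' = B \<inter> (e -` F \<inter> space M)"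
  have B' [measurable]: "B' \<in> sets M" "B' \<subseteq> B" unfolding B'_def by auto
  define N where "N = \<nu> B'"
  interpret N: finite_borel_measure N unfolding N_def by (rule fin) (use B' in auto)
  define c where "c = measure N UNIV"
  have "emeasure N UNIV \<noteq> 0" using F(3) by (simp add: N_def em B'_def Int_absorb1 inf_commute inf_left_commute)
  then have c: "c > 0" using N.emeasure_eq_measure[of UNIV] measure_nonneg[of N UNIV] by (simp add: c_def less_le)
  have Natom: "measure N {z} = 0" for z
  proof -
    have "emeasure N {z} \<le> emeasure M (e -` {z} \<inter> space M)"
      unfolding N_def using em[of B' "{z}"] by (auto intro: emeasure_mono)
    then show ?thesis by (simp add: atomless measure_def)
  qed
  have "B' \<inter> (e -` (- F) \<inter> space M) = {}" by (auto simp: B'_def)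
  then have "emeasure N (- F) = 0" using em[of B' "- F"] by (simp add: N_def)
  then have NF: "measure N (- F) = 0" by (simp add: measure_def)
  define q where "q t = (if 0 < t \<and> t < c then Inf {x. t \<le> cdf N x} else 0)" for t
  have [measurable]: "q \<in> borel_measurable borel"
    using measurable_quantile[OF N.finite_borel_measure_axioms Natom]
    by (simp add: q_def[abs_def] c_def)
  have q: "q t \<in> F" "cdf N (q t) = t" if "0 < t" "t < c" for t
    using quantile_in_closed[OF N.finite_borel_measure_axioms Natom, of t F]
      cdf_quantile(1)[OF N.finite_borel_measure_axioms Natom, of t] that compact_imp_closed[OF F(2)] NF
    by (auto simp: q_def c_def)
  have [measurable]: "cdf N \<in> borel_measurable borel"
    by (intro borel_measurable_mono monoI N.cdf_nondecreasing)
  \<comment> \<open>This inverts the coding used in \<open>i\<close> below, since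
    \<open>cdf N\<close> undoes \<open>q\<close>. The shift by 1/4 moves ternary codes from [0, 1/2]
    to [1/4, 3/4], strictly inside (0, 1), where \<open>q\<close> is a true quantile.\<close>
  define L where "L y = ternary_decode (cdf N (e y) / c - 1 / 4)" for y
  have L [measurable]: "L \<in> M \<rightarrow>\<^sub>M cantor" unfolding L_def[abs_def] by measurable
  have [measurable]: "(\<lambda>y. L y n) \<in> M \<rightarrow>\<^sub>M count_space UNIV" for n
    by (rule measurable_compose[OF L measurable_cantor_nth])
  have [measurable]: "(\<lambda>x. e0 x n) \<in> M \<rightarrow>\<^sub>M count_space UNIV" for n
    by (rule measurable_compose[OF e0 measurable_cantor_nth])
  \<comment> \<open>Odd digits carry the parameter \<open>s\<close>, even digits the code of the
    point.\<close>
  define D where "D y = (\<lambda>n. L y (2 * n + 1))" for y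
  have D [measurable]: "D \<in> M \<rightarrow>\<^sub>M cantor" by (rule measurable_cantorI) (unfold D_def, measurable)
  define r' where "r' y = r0 (\<lambda>n. L y (2 * n))" for y
  have "(\<lambda>y n. L y (2 * n)) \<in> M \<rightarrow>\<^sub>M cantor" by (rule measurable_cantorI) measurable
  then have r' [measurable]: "r' \<in> M \<rightarrow>\<^sub>M M" unfolding r'_def[abs_def] by measurable
  define i where "i s x = r (q (c * (ternary_code (\<lambda>n. if even n then e0 x (n div 2) else s (n div 2)) + 1 / 4)))"
    for s x
  have "(\<lambda>x n. if even n then e0 x (n div 2) else s (n div 2)) \<in> M \<rightarrow>\<^sub>M cantor" for s
    by (rule measurable_cantorI) measurable
  then have i [measurable]: "i s \<in> M \<rightarrow>\<^sub>M M" for s unfolding i_def[abs_def] by measurable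
  have Li: "L (i s x) = (\<lambda>n. if even n then e0 x (n div 2) else s (n div 2))" (is "_ = ?y") and iB: "i s x \<in> B" for s x
  proof -
    let ?t = "c * (ternary_code ?y + 1 / 4)"
    have t: "0 < ?t" "?t < c" using c ternary_code_bounds[of ?y] by auto
    have "q ?t \<in> K" using q(1)[OF t] F(1) by blast
    then have "e (i s x) = q ?t" "i s x \<in> B" by (simp_all add: K_def i_def)
    then show "L (i s x) = ?y" "i s x \<in> B" using q(2)[OF t] c by (simp_all add: L_def)
  qed
  have r'i: "r' (i s x) = x" if "x \<in> space M" for s x
    using r0e0[OF that] by (simp add: r'_def Li)
  have Di: "D (i s x) = s" for s x by (simp add: D_def Li)
  define \<rho> where "\<rho> = distr (density M (indicator B)) cantor D"
  have em\<rho>: "emeasure \<rho> E = emeasure M (B \<inter> (D -` E \<inter> space M))" if "E \<in> sets cantor" for E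
    using that by (simp add: \<rho>_def emeasure_distr emeasure_restricted)
  have "emeasure \<rho> UNIV \<le> emeasure M B" using em\<rho>[of UNIV] sets.top[of cantor] by (auto intro: emeasure_mono)
  then interpret \<rho>: finite_measure \<rho>
    using B(3) by (intro finite_measureI) (auto simp: top_unique \<rho>_def)
  \<comment> \<open>The copy with parameter \<open>s\<close> lies in the fibre of \<open>D\<close>
    over \<open>s\<close>. A finite measure charges only countably many singletons, and the Cantor
    space is uncountable.\<close>
  obtain s where "measure \<rho> {s} = 0"
    using \<rho>.countable_support uncountable_cantor by (metis (mono_tags, lifting) UNIV_eq_I mem_Collect_eq)
  then have "emeasure M (B \<inter> (D -` {s} \<inter> space M)) = 0"
    using em\<rho>[OF singleton_sets_cantor, of s] \<rho>.emeasure_eq_measure[of "{s}"] by (metis ennreal_0)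
  moreover have "i s ` space M \<subseteq> B \<inter> (D -` {s} \<inter> space M)"
    using iB Di measurable_space[OF i] by auto
  moreover have "i s ` space M \<in> sets M"
    by (rule sets_image_retract[OF sb i r' r'i]) auto
  moreover have "B \<inter> (D -` {s} \<inter> space M) \<in> sets M"
    using measurable_sets[OF D singleton_sets_cantor] by auto
  ultimately have "i s ` space M \<in> null_sets M"
    by (meson null_setsI null_sets_subset)
  then show ?thesis
    using that[OF i r' r'i] iB B(1) by blast
qed

section \<open>From almost invertible maps to automorphisms\<close>

text \<open>The classical bijection: \<open>f\<close> on the orbit \<open>C\<close> of the
  complement of the image of \<open>g\<close>, the inverse of \<open>g\<close> elsewhere. The last
  conclusion records which of the two maps is used at each point, so that \<open>h\<close> can be
  compared almost everywhere with a given map.\<close>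

lemma measurable_Schroeder_Bernstein:
  assumes sb: "standard_borel M"
    and f [measurable]: "f \<in> M \<rightarrow>\<^sub>M M" and f' [measurable]: "f' \<in> M \<rightarrow>\<^sub>M M"
    and g [measurable]: "g \<in> M \<rightarrow>\<^sub>M M" and g' [measurable]: "g' \<in> M \<rightarrow>\<^sub>M M"
    and f'f: "\<And>x. x \<in> space M \<Longrightarrow> f' (f x) = x" and g'g: "\<And>x. x \<in> space M \<Longrightarrow> g' (g x) = x"
  obtains h k where "h \<in> M \<rightarrow>\<^sub>M M" "k \<in> M \<rightarrow>\<^sub>M M"
    "\<And>x. x \<in> space M \<Longrightarrow> k (h x) = x" "\<And>x. x \<in> space M \<Longrightarrow> h (k x) = x"
    "\<And>x. x \<in> space M \<Longrightarrow> h x = f x \<or> h x = g' x \<and> g (g' x) = x"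
proof -
  define S where "S n = ((\<lambda>E. g ` f ` E) ^^ n) (space M - g ` space M)" for n
  have [measurable]: "S n \<in> sets M" for n
  proof (induction n)
    case 0
    have "g ` space M \<in> sets M" by (rule sets_image_retract[OF sb g g' g'g]) auto
    then show ?case by (simp add: S_def)
  next
    case (Suc n)
    have "f ` S n \<in> sets M" by (rule sets_image_retract[OF sb f f' f'f Suc.IH])
    then have "g ` f ` S n \<in> sets M" by (intro sets_image_retract[OF sb g g' g'g])
    then show ?case by (simp add: S_def)
  qed
  define C where "C = (\<Union>n. S n)"
  have [measurable]: "C \<in> sets M" unfolding C_def by measurable
  have fM: "f x \<in> space M" and gM: "g x \<in> space M" if "x \<in> space M" for x
    using that measurable_space[OF f] measurable_space[OF g] by auto
  have CM: "x \<in> space M" if "x \<in> C" for x using that sets.sets_into_space[of C M] by auto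
  have gf: "g (f x) \<in> C" if "x \<in> C" for x
  proof -
    from that obtain n where "x \<in> S n" by (auto simp: C_def)
    then have "g (f x) \<in> S (Suc n)" by (simp add: S_def)
    then show ?thesis unfolding C_def by blast
  qed
  have notC: "g (g' x) = x" "g' x \<in> space M" if x: "x \<in> space M" "x \<notin> C" for x
  proof -
    have "x \<notin> S 0" using x(2) by (auto simp: C_def)
    then obtain z where "z \<in> space M" "x = g z" using x(1) by (auto simp: S_def)
    then show "g (g' x) = x" "g' x \<in> space M" by (simp_all add: g'g)
  qed
  have inC: "\<exists>x\<in>C. y = f x" if "g y \<in> C" and y: "y \<in> space M" for y
  proof -
    obtain n where n: "g y \<in> S n" using \<open>g y \<in> C\<close> by (auto simp: C_def)
    then obtain m where "n = Suc m" using y by (cases n) (auto simp: S_def)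
    then obtain x where x: "x \<in> S m" "g y = g (f x)" using n by (auto simp: S_def)
    then have "x \<in> C" by (auto simp: C_def)
    then have "y = f x" using x(2) g'g[OF y] g'g[OF fM[OF CM]] by metis
    then show ?thesis using \<open>x \<in> C\<close> by blast
  qed
  define h where "h x = (if x \<in> C then f x else g' x)" for x
  \<comment> \<open>A point \<open>y\<close> lies in the image of \<open>C\<close> under
    \<open>f\<close> exactly when \<open>g y\<close> lies in \<open>C\<close>, since the stage
    \<open>S 0\<close> contains no value of \<open>g\<close>.\<close>
  define k where "k y = (if g y \<in> C then f' y else g y)" for y
  show ?thesis
  proof
    show "h \<in> M \<rightarrow>\<^sub>M M" unfolding h_def[abs_def] by measurable
    show "k \<in> M \<rightarrow>\<^sub>M M" unfolding k_def[abs_def] by measurable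
    fix x assume x: "x \<in> space M"
    show "k (h x) = x"
      using gf[of x] notC[OF x] f'f[OF x] by (cases "x \<in> C") (simp_all add: h_def k_def)
    show "h (k x) = x"
    proof (cases "g x \<in> C")
      case True
      then obtain z where "z \<in> C" "x = f z" using inC x by blast
      then show ?thesis using True f'f[OF CM] by (simp add: h_def k_def)
    next
      case False
      then show ?thesis using g'g[OF x] by (simp add: h_def k_def)
    qed
    show "h x = f x \<or> h x = g' x \<and> g (g' x) = x"
      using notC(1)[OF x] by (auto simp: h_def)
  qed
qed

section \<open>Corrections on null sets\<close>

lemma AE_compose_nonsingular:
  assumes T: "T \<in> M \<rightarrow>\<^sub>M M" and null: "\<And>N. N \<in> null_sets M \<Longrightarrow> T -` N \<inter> space M \<in> null_sets M"
    and P: "AE x in M. P x"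
  shows "AE x in M. P (T x)"
proof -
  obtain N where N: "N \<in> null_sets M" "{x \<in> space M. \<not> P x} \<subseteq> N"
    using P by (auto elim!: AE_E simp: null_sets_def)
  then show ?thesis
    using null[OF N(1)] measurable_space[OF T] by (intro AE_I'[of "T -` N \<inter> space M"]) auto
qed

text \<open>The exceptional set of \<open>T\<close> is moved into a null copy \<open>I\<close> of the space on which \<open>T\<close> is injective.\<close>

lemma AE_retraction_imp_retraction:
  assumes sb: "standard_borel M" and sf: "sigma_finite_measure M" and na: "non_atomic M"
    and pos: "emeasure M (space M) \<noteq> 0"
    and T [measurable]: "T \<in> M \<rightarrow>\<^sub>M M" "T' \<in> M \<rightarrow>\<^sub>M M" and ae: "AE x in M. T' (T x) = x"
  obtains f f' where "f \<in> M \<rightarrow>\<^sub>M M" "f' \<in> M \<rightarrow>\<^sub>M M" "\<And>x. x \<in> space M \<Longrightarrow> f' (f x) = x"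
    "AE x in M. f x = T x"
proof -
  define A where "A = {x \<in> space M. T' (T x) = x}"
  have [measurable]: "Measurable.pred M (\<lambda>x. T' (T x) = x)"
    using sb by (rule standard_borel_pred_eq) measurable
  have A [measurable]: "A \<in> sets M" unfolding A_def by measurable
  have AE_A: "AE x in M. x \<in> A" using ae by (auto simp: A_def)
  obtain i r where i [measurable]: "i \<in> M \<rightarrow>\<^sub>M M" and r [measurable]: "r \<in> M \<rightarrow>\<^sub>M M"
    and ri: "\<And>x. x \<in> space M \<Longrightarrow> r (i x) = x" and iA: "i ` space M \<subseteq> A" "i ` space M \<in> null_sets M"
    using non_atomic_null_retract[OF sb sf na pos A AE_A] by metis
  define I where "I = i ` space M"
  have [measurable]: "I \<in> sets M" using iA(2) by (auto simp: I_def)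
  define f where "f x = (if x \<in> A - I then T x else T (i x))" for x
  \<comment> \<open>Both branches of \<open>f\<close> apply \<open>T\<close> to a point of
    \<open>A\<close>, where \<open>T'\<close> recovers it. Whether that point is in \<open>I\<close>
    tells the branches apart, because the first one avoids \<open>I\<close>.\<close>
  define f' where "f' y = (if T' y \<in> I then r (T' y) else T' y)" for y
  show ?thesis
  proof
    show "f \<in> M \<rightarrow>\<^sub>M M" unfolding f_def[abs_def] by measurable
    show "f' \<in> M \<rightarrow>\<^sub>M M" unfolding f'_def[abs_def] by measurable
    fix x assume x: "x \<in> space M"
    show "f' (f x) = x"
    proof (cases "x \<in> A - I")
      case True
      then show ?thesis by (simp add: f_def f'_def A_def)
    next
      case False
      have "i x \<in> A" "i x \<in> I" using iA(1) x by (auto simp: I_def)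
      then show ?thesis using False ri[OF x] by (simp add: f_def f'_def A_def)
    qed
  next
    have "AE x in M. x \<notin> I" using iA(2) unfolding I_def by (rule AE_not_in)
    with AE_A show "AE x in M. f x = T x" by eventually_elim (simp add: f_def)
  qed
qed

text \<open>Both branches of the Schroeder-Bernstein map agree with \<open>T\<close> almost
  everywhere. For \<open>f\<close> this is part of its construction; for \<open>g'\<close> it
  follows from \<open>g (T x) = T' (T x) = x\<close> by applying \<open>g'\<close>. Nonsingularity
  of \<open>T\<close> is what lets the almost everywhere equality of \<open>g\<close> and
  \<open>T'\<close> be evaluated at \<open>T x\<close>.\<close>

lemma AE_inverse_imp_automorphism:
  assumes sb: "standard_borel M" and sf: "sigma_finite_measure M" and na: "non_atomic M"
    and pos: "emeasure M (space M) \<noteq> 0"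
    and T: "T \<in> M \<rightarrow>\<^sub>M M" "T' \<in> M \<rightarrow>\<^sub>M M"
    and ae: "AE x in M. T' (T x) = x" "AE x in M. T (T' x) = x"
    and null: "\<And>N. N \<in> null_sets M \<Longrightarrow> T -` N \<inter> space M \<in> null_sets M"
  obtains h k where "h \<in> M \<rightarrow>\<^sub>M M" "k \<in> M \<rightarrow>\<^sub>M M"
    "\<And>x. x \<in> space M \<Longrightarrow> k (h x) = x" "\<And>x. x \<in> space M \<Longrightarrow> h (k x) = x"
    "AE x in M. h x = T x"
proof -
  obtain f f' where f: "f \<in> M \<rightarrow>\<^sub>M M" "f' \<in> M \<rightarrow>\<^sub>M M" "\<And>x. x \<in> space M \<Longrightarrow> f' (f x) = x"
    "AE x in M. f x = T x"
    by (rule AE_retraction_imp_retraction[OF sb sf na pos T ae(1)]) (rule that)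
  obtain g g' where g: "g \<in> M \<rightarrow>\<^sub>M M" "g' \<in> M \<rightarrow>\<^sub>M M" "\<And>x. x \<in> space M \<Longrightarrow> g' (g x) = x"
    "AE x in M. g x = T' x"
    by (rule AE_retraction_imp_retraction[OF sb sf na pos T(2,1) ae(2)]) (rule that)
  obtain h k where hk: "h \<in> M \<rightarrow>\<^sub>M M" "k \<in> M \<rightarrow>\<^sub>M M"
    "\<And>x. x \<in> space M \<Longrightarrow> k (h x) = x" "\<And>x. x \<in> space M \<Longrightarrow> h (k x) = x"
    "\<And>x. x \<in> space M \<Longrightarrow> h x = f x \<or> h x = g' x \<and> g (g' x) = x"
    by (rule measurable_Schroeder_Bernstein[OF sb f(1,2) g(1,2) f(3) g(3)]) (assumption | rule that)+
  have "AE x in M. g (T x) = T' (T x)"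
    by (rule AE_compose_nonsingular[OF T(1) null g(4)])
  then have "AE x in M. h x = T x"
    using ae(1) f(4) AE_space
  proof eventually_elim
    case (elim x)
    then have "g' x = T x" using g(3)[of "T x"] measurable_space[OF T(1)] by simp
    then show ?case using hk(5)[of x] elim by auto
  qed
  then show ?thesis using that hk by blast
qed

text \<open>Sets related to the coordinate sets of the code serve as the bits of a new code
  \<open>t\<close>, which \<open>r\<close> turns into a point map. The relation then spreads over
  the generated sigma-algebra. A relation, not a function, appears because partners are determined
  only up to null sets; this also lets the lemma apply to the converse relation.\<close>

lemma set_correspondence_realization:
  assumes sb: "standard_borel M" and ne: "space M \<noteq> {}"
    and total: "\<And>E. E \<in> sets M \<Longrightarrow> \<exists>F\<in>sets M. R E F"
    and empty: "R {} {}"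
    and compl: "\<And>E F. E \<in> sets M \<Longrightarrow> F \<in> sets M \<Longrightarrow> R E F \<Longrightarrow> R (space M - E) (space M - F)"
    and union: "\<And>E F. range E \<subseteq> sets M \<Longrightarrow> range F \<subseteq> sets M \<Longrightarrow> (\<And>n::nat. R (E n) (F n)) \<Longrightarrow>
      R (\<Union>n. E n) (\<Union>n. F n)"
  obtains T where "T \<in> M \<rightarrow>\<^sub>M M" "\<And>E. E \<in> sets M \<Longrightarrow> R E (T -` E \<inter> space M)"
proof -
  obtain e r where e: "e \<in> M \<rightarrow>\<^sub>M cantor" and r: "r \<in> cantor \<rightarrow>\<^sub>M M"
    and re: "\<And>x. x \<in> space M \<Longrightarrow> r (e x) = x"
    using standard_borel_retract[OF sb ne] by metis
  have E: "{x \<in> space M. e x n} \<in> sets M" for n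
    using measurable_compose[OF e measurable_cantor_nth, of n] by (simp add: pred_def)
  obtain B where B: "\<And>n. B n \<in> sets M" "\<And>n. R {x \<in> space M. e x n} (B n)"
    using total[OF E] by metis
  define t where "t x = (\<lambda>n. x \<in> B n)" for x
  have "Measurable.pred M (\<lambda>x. t x n)" for n
    using B(1)[of n] unfolding t_def by measurable
  then have t: "t \<in> M \<rightarrow>\<^sub>M cantor" by (rule measurable_cantorI)
  have main: "R (e -` D \<inter> space M) (t -` D \<inter> space M)" if "D \<in> sets cantor" for D
  proof -
    have "D \<in> sigma_sets UNIV (range (\<lambda>n. {y. y n}))" using that sets_cantor by simp
    then show ?thesis
    proof (induction D rule: sigma_sets.induct)
      case (Basic D)
      then obtain n where "D = {y. y n}" by blast
      then have "e -` D \<inter> space M = {x \<in> space M. e x n}" "t -` D \<inter> space M = B n"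
        using sets.sets_into_space[OF B(1)] by (auto simp: t_def)
      then show ?case using B(2) by simp
    next
      case Empty
      then show ?case using empty by simp
    next
      case (Compl D)
      then have "D \<in> sets cantor" by (simp add: sets_cantor)
      then have "R (space M - (e -` D \<inter> space M)) (space M - (t -` D \<inter> space M))"
        using Compl.IH measurable_sets[OF e] measurable_sets[OF t] by (intro compl) auto
      moreover have "space M - (e -` D \<inter> space M) = e -` (UNIV - D) \<inter> space M"
        "space M - (t -` D \<inter> space M) = t -` (UNIV - D) \<inter> space M" by auto
      ultimately show ?case by simp
    next
      case (Union D)
      then have "\<And>n. D n \<in> sets cantor" by (simp add: sets_cantor)
      then have "R (\<Union>n. e -` D n \<inter> space M) (\<Union>n. t -` D n \<inter> space M)"
        using Union.IH measurable_sets[OF e] measurable_sets[OF t] by (intro union) auto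
      moreover have "(\<Union>n. e -` D n \<inter> space M) = e -` (\<Union>n. D n) \<inter> space M"
        "(\<Union>n. t -` D n \<inter> space M) = t -` (\<Union>n. D n) \<inter> space M" by auto
      ultimately show ?case by simp
    qed
  qed
  show ?thesis
  proof
    show "(\<lambda>x. r (t x)) \<in> M \<rightarrow>\<^sub>M M" using t r by measurable
    fix E assume E: "E \<in> sets M"
    \<comment> \<open>The retraction exhibits every measurable set as the preimage under
      \<open>e\<close> of a measurable set of codes.\<close>
    have "e -` (r -` E) \<inter> space M = E" using re sets.sets_into_space[OF E] by auto
    moreover have "t -` (r -` E) = (\<lambda>x. r (t x)) -` E" by auto
    ultimately show "R E ((\<lambda>x. r (t x)) -` E \<inter> space M)"
      using main[of "r -` E"] measurable_sets[OF r E] by simp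
  qed
qed

section \<open>The unitary of a nonsingular automorphism\<close>

lemma L2_measurable: "f \<in> L2 M \<Longrightarrow> f \<in> borel_measurable M"
  by (simp add: L2_def)

lemma L2_cmult: "f \<in> L2 M \<Longrightarrow> (\<lambda>x. c * f x) \<in> L2 M"
  by (auto simp: L2_def norm_mult power_mult_distrib)

lemma integrable_cnj_mult:
  assumes "f \<in> L2 M" "g \<in> L2 M"
  shows "integrable M (\<lambda>x. cnj (f x) * g x)"
proof (rule Bochner_Integration.integrable_bound)
  show "integrable M (\<lambda>x. (cmod (f x))\<^sup>2 + (cmod (g x))\<^sup>2)" using assms by (simp add: L2_def)
  show "(\<lambda>x. cnj (f x) * g x) \<in> borel_measurable M"
  proof -
    have [measurable]: "f \<in> borel_measurable M" "g \<in> borel_measurable M" using assms by (simp_all add: L2_def)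
    have "cnj \<in> borel_measurable borel" by (intro borel_measurable_continuous_onI continuous_intros)
    from measurable_compose[OF \<open>f \<in> borel_measurable M\<close> this] show ?thesis by measurable
  qed
  have "a * b \<le> a\<^sup>2 + b\<^sup>2" if "0 \<le> a" "0 \<le> b" for a b :: real
    using that sum_squares_bound[of a b] mult_nonneg_nonneg[OF that] by linarith
  then have "norm (cnj (f x) * g x) \<le> norm ((cmod (f x))\<^sup>2 + (cmod (g x))\<^sup>2)" for x
    by (simp add: norm_mult)
  then show "AE x in M. norm (cnj (f x) * g x) \<le> norm ((cmod (f x))\<^sup>2 + (cmod (g x))\<^sup>2)" by simp
qed

lemma L2_bound:
  assumes "f \<in> borel_measurable M" "g \<in> L2 M" "AE x in M. cmod (f x) \<le> cmod (g x)"
  shows "f \<in> L2 M"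
proof -
  have "integrable M (\<lambda>x. (cmod (f x))\<^sup>2)"
  proof (rule Bochner_Integration.integrable_bound)
    show "integrable M (\<lambda>x. (cmod (g x))\<^sup>2)" using assms(2) by (simp add: L2_def)
    show "(\<lambda>x. (cmod (f x))\<^sup>2) \<in> borel_measurable M" using assms(1) by measurable
    show "AE x in M. norm ((cmod (f x))\<^sup>2) \<le> norm ((cmod (g x))\<^sup>2)"
      using assms(3) by eventually_elim (simp add: power_mono)
  qed
  then show ?thesis using assms(1) by (simp add: L2_def)
qed

lemma L2_add:
  assumes "f \<in> L2 M" "g \<in> L2 M"
  shows "(\<lambda>x. f x + g x) \<in> L2 M"
proof -
  have [measurable]: "f \<in> borel_measurable M" "g \<in> borel_measurable M" using assms by (simp_all add: L2_def)
  have "integrable M (\<lambda>x. (cmod (f x + g x))\<^sup>2)"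
  proof (rule Bochner_Integration.integrable_bound)
    show "integrable M (\<lambda>x. 2 * (cmod (f x))\<^sup>2 + 2 * (cmod (g x))\<^sup>2)" using assms by (simp add: L2_def)
    have "(cmod (a + b))\<^sup>2 \<le> 2 * (cmod a)\<^sup>2 + 2 * (cmod b)\<^sup>2" for a b
    proof -
      have "(cmod (a + b))\<^sup>2 \<le> (cmod a + cmod b)\<^sup>2" by (intro power_mono norm_triangle_ineq) simp
      also have "\<dots> \<le> 2 * (cmod a)\<^sup>2 + 2 * (cmod b)\<^sup>2"
        using sum_squares_bound[of "cmod a" "cmod b"] by (simp add: power2_sum)
      finally show ?thesis .
    qed
    then show "AE x in M. norm ((cmod (f x + g x))\<^sup>2) \<le> norm (2 * (cmod (f x))\<^sup>2 + 2 * (cmod (g x))\<^sup>2)" by simp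
  qed measurable
  then show ?thesis by (simp add: L2_def)
qed

lemma L2_diff: "f \<in> L2 M \<Longrightarrow> g \<in> L2 M \<Longrightarrow> (\<lambda>x. f x - g x) \<in> L2 M"
  using L2_add[OF _ L2_cmult[of g M "-1"], of f] by simp

lemma L2_zero: "(\<lambda>_. 0) \<in> L2 M"
  by (simp add: L2_def)

lemma L2_indicator_mult:
  assumes "f \<in> L2 M" "E \<in> sets M"
  shows "(\<lambda>x. f x * indicator E x) \<in> L2 M"
proof (rule L2_bound[OF _ assms(1)])
  show "(\<lambda>x. f x * indicator E x) \<in> borel_measurable M"
    using assms(2) L2_measurable[OF assms(1)] by measurable
qed (simp split: split_indicator)

section \<open>Change of variables and the operator \<open>U_op\<close>\<close>

locale nonsingular_automorphism = sigma_finite_measure M for M :: "'a measure" +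
  fixes S :: "'a \<Rightarrow> 'a"
  assumes aut: "nonsingular_aut M S"
begin

abbreviation T :: "'a \<Rightarrow> 'a" where "T \<equiv> inv_into (space M) S"

lemma measurable_S [measurable]: "S \<in> M \<rightarrow>\<^sub>M M" and measurable_T [measurable]: "T \<in> M \<rightarrow>\<^sub>M M"
  using aut by (simp_all add: nonsingular_aut_def)

lemma S_space: "x \<in> space M \<Longrightarrow> S x \<in> space M" and T_space: "x \<in> space M \<Longrightarrow> T x \<in> space M"
  by (rule measurable_space[OF measurable_S], simp) (rule measurable_space[OF measurable_T])

lemma T_S [simp]: "x \<in> space M \<Longrightarrow> T (S x) = x" and S_T [simp]: "x \<in> space M \<Longrightarrow> S (T x) = x"
  using aut unfolding nonsingular_aut_def
  by (auto simp: bij_betw_def inv_into_f_f f_inv_into_f)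

lemma AE_S: "AE x in M. P x \<Longrightarrow> AE x in M. P (S x)"
  by (erule AE_compose_nonsingular[OF measurable_S, rotated])
    (use aut measurable_sets[OF measurable_S] in \<open>auto simp: nonsingular_aut_def null_sets_def\<close>)

lemma AE_T: assumes "AE x in M. P x" shows "AE x in M. P (T x)"
proof (rule AE_compose_nonsingular[OF measurable_T _ assms])
  fix N assume N: "N \<in> null_sets M"
  have "S -` (T -` N \<inter> space M) \<inter> space M = N"
    using sets.sets_into_space[of N M] null_setsD2[OF N] S_space by (auto simp: subset_iff)
  then show "T -` N \<inter> space M \<in> null_sets M"
    using aut N measurable_sets[OF measurable_T, of N] unfolding nonsingular_aut_def null_sets_def by auto
qed

lemma AE_T_iff: "(AE x in M. P (T x)) \<longleftrightarrow> (AE x in M. P x)"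
proof
  assume "AE x in M. P (T x)"
  then have "AE x in M. P (T (S x))" by (rule AE_S)
  then show "AE x in M. P x" using AE_space by eventually_elim simp
qed (rule AE_T)

lemma Sprime_measurable [measurable]: "Sprime M S \<in> borel_measurable M"
  unfolding Sprime_def[abs_def] by measurable

lemma Sprime_nonneg [simp]: "0 \<le> Sprime M S x"
  by (simp add: Sprime_def)

text \<open>\<open>Sprime\<close> truncates the Radon-Nikodym derivative by \<open>enn2real\<close>,
  which is harmless only where the derivative is finite. That needs the image measure to be
  sigma-finite, which holds because \<open>T\<close> pushes it back to \<open>M\<close>.\<close>

lemma density_Sprime: "density M (\<lambda>x. ennreal (Sprime M S x)) = distr M M S"
proof -
  have "distr (distr M M S) M T = distr M M (\<lambda>x. T (S x))"
    by (subst distr_distr) (auto simp: comp_def)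
  also have "\<dots> = distr M M (\<lambda>x. x)" by (rule distr_cong) auto
  finally have "sigma_finite_measure (distr (distr M M S) M T)"
    using sigma_finite_measure_axioms by (simp add: distr_id[unfolded id_def])
  then have sf: "sigma_finite_measure (distr M M S)"
    by (rule sigma_finite_measure_distr) simp
  have ac: "absolutely_continuous M (distr M M S)"
    using aut by (auto simp: absolutely_continuous_def null_sets_def emeasure_distr nonsingular_aut_def)
  have "AE x in M. RN_deriv M (distr M M S) x \<noteq> \<infinity>"
    by (rule RN_deriv_finite[OF sf ac]) simp
  then have "AE x in M. ennreal (Sprime M S x) = RN_deriv M (distr M M S) x"
    by eventually_elim (simp add: Sprime_def less_top)
  then have "density M (\<lambda>x. ennreal (Sprime M S x)) = density M (RN_deriv M (distr M M S))"
    by (intro density_cong) auto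
  also have "\<dots> = distr M M S" by (rule density_RN_deriv[OF ac]) simp
  finally show ?thesis .
qed

text \<open>The zero set of the density has image measure zero, so its preimage under
  \<open>S\<close> is null, and nonsingularity makes the set itself null.\<close>

lemma Sprime_pos: "AE x in M. 0 < Sprime M S x"
proof -
  define Z where "Z = {x \<in> space M. Sprime M S x = 0}"
  have Z [measurable]: "Z \<in> sets M" unfolding Z_def by measurable
  have "Z \<in> null_sets (density M (\<lambda>x. ennreal (Sprime M S x)))"
    by (subst null_sets_density_iff) (auto simp: Z_def)
  then have "emeasure M (S -` Z \<inter> space M) = 0"
    unfolding density_Sprime by (auto simp: null_sets_def emeasure_distr)
  then have "emeasure M Z = 0" using aut Z by (simp add: nonsingular_aut_def)
  then have "AE x in M. x \<notin> Z" using Z by (intro AE_not_in) (simp add: null_sets_def)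
  then show ?thesis using AE_space by eventually_elim (simp add: Z_def less_le)
qed

text \<open>Change of variables: the density turns \<open>M\<close> into its image under
  \<open>S\<close>, and \<open>T\<close> composed with \<open>S\<close> is the identity.\<close>

lemma integrable_Sprime:
  fixes f :: "'a \<Rightarrow> 'b :: {banach, second_countable_topology}"
  assumes [measurable]: "f \<in> borel_measurable M"
  shows "integrable M (\<lambda>x. Sprime M S x *\<^sub>R f (T x)) \<longleftrightarrow> integrable M f"
    and "(\<integral>x. Sprime M S x *\<^sub>R f (T x) \<partial>M) = (\<integral>x. f x \<partial>M)"
proof -
  have "integrable M (\<lambda>x. Sprime M S x *\<^sub>R f (T x)) \<longleftrightarrow> integrable M (\<lambda>x. f (T (S x)))"
    by (subst integrable_density[symmetric]) (auto simp: density_Sprime integrable_distr_eq)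
  also have "\<dots> \<longleftrightarrow> integrable M f" by (intro Bochner_Integration.integrable_cong) auto
  finally show "integrable M (\<lambda>x. Sprime M S x *\<^sub>R f (T x)) \<longleftrightarrow> integrable M f" .
  have "(\<integral>x. Sprime M S x *\<^sub>R f (T x) \<partial>M) = (\<integral>x. f (T (S x)) \<partial>M)"
    by (subst integral_density[symmetric]) (auto simp: density_Sprime integral_distr)
  also have "\<dots> = (\<integral>x. f x \<partial>M)" by (intro Bochner_Integration.integral_cong) auto
  finally show "(\<integral>x. Sprime M S x *\<^sub>R f (T x) \<partial>M) = (\<integral>x. f x \<partial>M)" .
qed

lemma U_op_measurable [measurable]: "f \<in> borel_measurable M \<Longrightarrow> U_op M S f \<in> borel_measurable M"
  unfolding U_op_def using measurable_compose[OF measurable_T, of f borel] by measurable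

lemma U_op_L2_iff:
  assumes [measurable]: "f \<in> borel_measurable M"
  shows "U_op M S f \<in> L2 M \<longleftrightarrow> f \<in> L2 M"
proof -
  have "(\<lambda>x. (cmod (U_op M S f x))\<^sup>2) = (\<lambda>x. Sprime M S x *\<^sub>R (cmod (f (T x)))\<^sup>2)"
    by (auto simp: U_op_def norm_mult power_mult_distrib)
  then show ?thesis using integrable_Sprime(1)[of "\<lambda>x. (cmod (f x))\<^sup>2"] by (simp add: L2_def)
qed

lemma U_op_real: "AE x in M. f x \<in> \<real> \<Longrightarrow> AE x in M. U_op M S f x \<in> \<real>"
  by (drule AE_T) (auto simp: U_op_def elim!: eventually_mono)

lemma U_op_surj:
  assumes "g \<in> L2 M"
  obtains f where "f \<in> L2 M" "ae_eq M (U_op M S f) g" "(AE x in M. g x \<in> \<real>) \<Longrightarrow> AE x in M. f x \<in> \<real>"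
proof -
  have [measurable]: "g \<in> borel_measurable M" using assms by (rule L2_measurable)
  \<comment> \<open>The inverse operator written out; the division is legitimate almost everywhere
    because the density is positive there.\<close>
  define f where "f x = g (S x) / complex_of_real (sqrt (Sprime M S (S x)))" for x
  have [measurable]: "f \<in> borel_measurable M" unfolding f_def[abs_def] by measurable
  have "AE x in M. U_op M S f x = g x"
    using Sprime_pos AE_space by eventually_elim (simp add: U_op_def f_def)
  then have eq: "ae_eq M (U_op M S f) g" by (simp add: ae_eq_def)
  then have "U_op M S f \<in> L2 M"
    by (intro L2_bound[OF _ assms]) (auto simp: ae_eq_def)
  then have "f \<in> L2 M" by (simp add: U_op_L2_iff)
  moreover have "AE x in M. f x \<in> \<real>" if "AE x in M. g x \<in> \<real>"
    using AE_S[OF that] by eventually_elim (auto simp: f_def intro: Reals_divide)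
  ultimately show ?thesis using that eq by blast
qed

lemma U_op_inner:
  assumes "f \<in> L2 M" "g \<in> L2 M"
  shows "l2_inner M (U_op M S f) (U_op M S g) = l2_inner M f g"
proof -
  have "l2_inner M (U_op M S f) (U_op M S g) = (\<integral>x. Sprime M S x *\<^sub>R (cnj (f (T x)) * g (T x)) \<partial>M)"
    unfolding l2_inner_def
  proof (intro Bochner_Integration.integral_cong refl)
    fix x
    have "complex_of_real (sqrt (Sprime M S x)) * complex_of_real (sqrt (Sprime M S x)) = Sprime M S x"
      by (simp flip: of_real_mult)
    then have "cnj (U_op M S f x) * U_op M S g x = Sprime M S x * (cnj (f (T x)) * g (T x))"
      by (simp add: U_op_def mult.assoc mult.left_commute)
    then show "cnj (U_op M S f x) * U_op M S g x = Sprime M S x *\<^sub>R (cnj (f (T x)) * g (T x))"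
      by (simp add: scaleR_conv_of_real)
  qed
  also have "\<dots> = l2_inner M f g"
    unfolding l2_inner_def
    using integrable_cnj_mult[OF assms] by (intro integrable_Sprime(2)) (rule borel_measurable_integrable)
  finally show ?thesis .
qed

lemma unitary_R_U_op: "unitary_R M (U_op M S)"
proof -
  have L2: "U_op M S f \<in> L2 M" if "f \<in> L2 M" for f
    using that by (simp add: U_op_L2_iff L2_measurable)
  have "ae_eq M (U_op M S f) (U_op M S g)" if "ae_eq M f g" for f g
    using AE_T[OF that[unfolded ae_eq_def]] unfolding ae_eq_def by eventually_elim (simp add: U_op_def)
  moreover have "\<exists>f\<in>L2 M. ae_eq M (U_op M S f) g" if "g \<in> L2 M" for g
    using U_op_surj[OF that] by metis
  moreover have "\<exists>f\<in>L2R M. ae_eq M (U_op M S f) g" if "g \<in> L2R M" for g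
    using U_op_surj[of g] that unfolding L2R_def by blast
  moreover have "ae_eq M (U_op M S (\<lambda>x. f x + g x)) (\<lambda>x. U_op M S f x + U_op M S g x)" for f g
    by (simp add: ae_eq_def U_op_def distrib_left)
  moreover have "ae_eq M (U_op M S (\<lambda>x. c * f x)) (\<lambda>x. c * U_op M S f x)" for f c
    by (simp add: ae_eq_def U_op_def)
  moreover have "U_op M S f \<in> L2R M" if "f \<in> L2R M" for f
    using that L2 U_op_real unfolding L2R_def by blast
  ultimately show ?thesis unfolding unitary_R_def unitary_L2_def using L2 U_op_inner by blast
qed

end

lemma Aut2_preserves:
  assumes "sigma_finite_measure M" "S \<in> Aut2 M"
  shows "(sqrtSp_m1 M S, U_op M S) \<in> Aff_R M"
    and "aff_preserves M (sqrtSp_m1 M S, U_op M S) (C_minus1 M)"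
proof -
  interpret nonsingular_automorphism M S
    using assms by (simp add: nonsingular_automorphism_def nonsingular_automorphism_axioms_def Aut2_def)
  let ?T = "inv_into (space M) S"
  have s: "sqrtSp_m1 M S \<in> L2 M" using assms(2) by (simp add: Aut2_def)
  have sR: "sqrtSp_m1 M S x \<in> \<real>" for x by (simp add: sqrtSp_m1_def)
  show "(sqrtSp_m1 M S, U_op M S) \<in> Aff_R M"
    using s sR unitary_R_U_op by (simp add: Aff_R_def L2R_def)
  \<comment> \<open>In the variable \<open>h + 1\<close> the affine map is multiplication by a
    nonnegative factor after composition with \<open>S\<close> inverse. Preservation of the bound -1
    becomes preservation of nonnegativity.\<close>
  have apply_eq: "aff_apply (sqrtSp_m1 M S, U_op M S) h x = complex_of_real (sqrt (Sprime M S x)) * (h (?T x) + 1) - 1" for h x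
    by (simp add: aff_apply_def sqrtSp_m1_def U_op_def algebra_simps)
  show "aff_preserves M (sqrtSp_m1 M S, U_op M S) (C_minus1 M)"
    unfolding aff_preserves_def
  proof (intro conjI ballI)
    fix h assume h: "h \<in> C_minus1 M"
    then have "h \<in> L2 M" and AE_h: "AE x in M. h x \<in> \<real> \<and> Re (h x) \<ge> -1" by (auto simp: C_minus1_def)
    then have "aff_apply (sqrtSp_m1 M S, U_op M S) h \<in> L2 M"
      using L2_add[OF s, of "U_op M S h"] by (simp add: aff_apply_def U_op_L2_iff L2_measurable)
    moreover have "AE x in M. aff_apply (sqrtSp_m1 M S, U_op M S) h x \<in> \<real> \<and>
        Re (aff_apply (sqrtSp_m1 M S, U_op M S) h x) \<ge> -1"
      using AE_T[OF AE_h]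
    proof eventually_elim
      case (elim x)
      then have "0 \<le> sqrt (Sprime M S x) * (Re (h (?T x)) + 1)" by (intro mult_nonneg_nonneg) auto
      then show ?case using elim by (auto simp: apply_eq intro!: Reals_diff Reals_mult Reals_add)
    qed
    ultimately show "aff_apply (sqrtSp_m1 M S, U_op M S) h \<in> C_minus1 M" by (simp add: C_minus1_def)
  next
    fix g assume g: "g \<in> C_minus1 M"
    then have "g \<in> L2 M" and AE_g: "AE x in M. g x \<in> \<real> \<and> Re (g x) \<ge> -1" by (auto simp: C_minus1_def)
    then have "(\<lambda>x. g x - sqrtSp_m1 M S x) \<in> L2 M" using s by (intro L2_diff)
    from U_op_surj[OF this] obtain h where h: "h \<in> L2 M" "ae_eq M (U_op M S h) (\<lambda>x. g x - sqrtSp_m1 M S x)"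
      "(AE x in M. g x - sqrtSp_m1 M S x \<in> \<real>) \<Longrightarrow> AE x in M. h x \<in> \<real>"
        by blast
    have eq: "ae_eq M (aff_apply (sqrtSp_m1 M S, U_op M S) h) g"
      using h(2) unfolding ae_eq_def by eventually_elim (simp add: aff_apply_def)
    have "AE x in M. h x \<in> \<real>"
      using AE_g sR by (intro h(3)) (auto elim!: eventually_mono)
    moreover have "AE x in M. Re (h (?T x)) \<ge> -1"
      using AE_g eq[unfolded ae_eq_def] Sprime_pos
    proof eventually_elim
      case (elim x)
      then have "Re (complex_of_real (sqrt (Sprime M S x)) * (h (?T x) + 1) - 1) = Re (g x)"
        by (simp only: apply_eq)
      then have "0 \<le> sqrt (Sprime M S x) * (Re (h (?T x)) + 1)" using elim(1) by simp
      then have "0 \<le> Re (h (?T x)) + 1" using elim by (simp add: zero_le_mult_iff)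
      then show ?case by simp
    qed
    ultimately have "AE x in M. h x \<in> \<real> \<and> Re (h x) \<ge> -1" by (simp add: AE_T_iff[of "\<lambda>y. Re (h y) \<ge> -1"])
    then show "\<exists>h\<in>C_minus1 M. ae_eq M (aff_apply (sqrtSp_m1 M S, U_op M S) h) g"
      using h(1) eq by (auto simp: C_minus1_def)
  qed
qed

section \<open>Unitaries preserving positivity\<close>

lemma l2_inner_cong_AE:
  assumes "f \<in> L2 M" "f' \<in> L2 M" "g \<in> L2 M" "g' \<in> L2 M" "AE x in M. f x = f' x" "AE x in M. g x = g' x"
  shows "l2_inner M f g = l2_inner M f' g'"
  unfolding l2_inner_def
proof (rule integral_cong_AE)
  show "AE x in M. cnj (f x) * g x = cnj (f' x) * g' x"
    using assms(5,6) by eventually_elim simp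
qed (intro borel_measurable_integrable integrable_cnj_mult assms)+

lemma nonneg_orthogonal_imp_disjoint:
  assumes "a \<in> L2 M" "b \<in> L2 M" and nonneg: "AE x in M. a x \<in> \<real>\<^sub>\<ge>\<^sub>0" "AE x in M. b x \<in> \<real>\<^sub>\<ge>\<^sub>0"
    and orth: "l2_inner M a b = 0"
  shows "AE x in M. a x = 0 \<or> b x = 0"
proof -
  have int: "integrable M (\<lambda>x. cnj (a x) * b x)" using assms(1,2) by (rule integrable_cnj_mult)
  have prod: "AE x in M. cnj (a x) * b x = complex_of_real (Re (cnj (a x) * b x)) \<and> 0 \<le> Re (cnj (a x) * b x)"
    using nonneg by eventually_elim (auto simp: complex_nonneg_Reals_iff complex_eq_iff)
  have "(\<integral>x. Re (cnj (a x) * b x) \<partial>M) = Re (l2_inner M a b)"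
    unfolding l2_inner_def by (rule integral_Re[OF int])
  then have "AE x in M. Re (cnj (a x) * b x) = 0"
    using orth prod integral_nonneg_eq_0_iff_AE[OF integrable_Re[OF int]] by (auto elim!: eventually_mono)
  with prod show ?thesis
    by eventually_elim (metis complex_cnj_zero_iff mult_eq_0_iff of_real_0)
qed

lemma disjoint_summand_eq_indicator:
  assumes "AE x in M. a x + b x = c x" "AE x in M. a x = 0 \<or> b x = (0 :: complex)"
  shows "AE x in M. a x = c x * indicator {x \<in> space M. a x \<noteq> 0} x"
  using assms AE_space by eventually_elim (auto split: split_indicator)

text \<open>Only the countably many coordinate sets of an injective code are tested, so a single
  null set suffices.\<close>

lemma AE_fixes_sets_imp_AE_id:
  assumes sb: "standard_borel M" and \<phi>: "\<phi> \<in> M \<rightarrow>\<^sub>M M"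
    and eq: "\<And>E. E \<in> sets M \<Longrightarrow> AE x in M. x \<in> E \<longleftrightarrow> \<phi> x \<in> E"
  shows "AE x in M. \<phi> x = x"
proof (cases "space M = {}")
  case True
  then show ?thesis by (intro AE_I2) simp
next
  case False
  obtain e r where e: "e \<in> M \<rightarrow>\<^sub>M cantor" and r: "r \<in> cantor \<rightarrow>\<^sub>M M" "\<And>x. x \<in> space M \<Longrightarrow> r (e x) = x"
    using standard_borel_retract[OF sb False] by metis
  have "{x \<in> space M. e x n} \<in> sets M" for n
    using measurable_compose[OF e measurable_cantor_nth, of n] by (simp add: pred_def)
  then have "AE x in M. \<forall>n. x \<in> {x \<in> space M. e x n} \<longleftrightarrow> \<phi> x \<in> {x \<in> space M. e x n}"
    using eq by (subst AE_all_countable) blast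
  then show ?thesis using AE_space
  proof eventually_elim
    case (elim x)
    then have "\<phi> x \<in> space M" using measurable_space[OF \<phi>] by simp
    then have "e x n \<longleftrightarrow> e (\<phi> x) n" for n using elim by auto
    then have "e x = e (\<phi> x)" by (intro ext)
    then show ?case using r(2) elim(2) \<open>\<phi> x \<in> space M\<close> by metis
  qed
qed

section \<open>Unitaries up to almost everywhere equality\<close>

locale unitary_operator = sigma_finite_measure M for M :: "'a measure" +
  fixes V :: "('a \<Rightarrow> complex) \<Rightarrow> 'a \<Rightarrow> complex"
  assumes unitary: "unitary_L2 M V"
begin

lemma V_L2: "f \<in> L2 M \<Longrightarrow> V f \<in> L2 M"
  and V_cong: "f \<in> L2 M \<Longrightarrow> g \<in> L2 M \<Longrightarrow> AE x in M. f x = g x \<Longrightarrow> AE x in M. V f x = V g x"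
  and V_add: "f \<in> L2 M \<Longrightarrow> g \<in> L2 M \<Longrightarrow> AE x in M. V (\<lambda>x. f x + g x) x = V f x + V g x"
  and V_cmult: "f \<in> L2 M \<Longrightarrow> AE x in M. V (\<lambda>x. c * f x) x = c * V f x"
  and V_inner: "f \<in> L2 M \<Longrightarrow> g \<in> L2 M \<Longrightarrow> l2_inner M (V f) (V g) = l2_inner M f g"
  and V_surj: "g \<in> L2 M \<Longrightarrow> \<exists>f\<in>L2 M. AE x in M. V f x = g x"
  using unitary by (simp_all add: unitary_L2_def ae_eq_def)

lemma V_diff:
  assumes "f \<in> L2 M" "g \<in> L2 M"
  shows "AE x in M. V (\<lambda>x. f x - g x) x = V f x - V g x"
  using V_add[OF assms(1) L2_cmult[OF assms(2), of "-1"]] V_cmult[OF assms(2), of "-1"]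
  by eventually_elim simp

lemma V_zero: "AE x in M. V (\<lambda>_. 0) x = 0"
  using V_cmult[OF L2_zero, of 0] by simp

lemma V_inj:
  assumes "f \<in> L2 M" "g \<in> L2 M" "AE x in M. V f x = V g x"
  shows "AE x in M. f x = g x"
proof -
  let ?d = "\<lambda>x. f x - g x"
  have d: "?d \<in> L2 M" using assms by (intro L2_diff)
  have "AE x in M. V ?d x = 0" using V_diff[OF assms(1,2)] assms(3) by eventually_elim simp
  then have "l2_inner M (V ?d) (V ?d) = l2_inner M (\<lambda>_. 0) (\<lambda>_. 0)"
    by (intro l2_inner_cong_AE V_L2 d L2_zero)
  then have "l2_inner M ?d ?d = 0" using V_inner[OF d d] by (simp add: l2_inner_def)
  moreover have "l2_inner M ?d ?d = (\<integral>x. complex_of_real ((cmod (?d x))\<^sup>2) \<partial>M)"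
    unfolding l2_inner_def
    by (intro Bochner_Integration.integral_cong refl) (metis complex_norm_square mult.commute of_real_power)
  ultimately have "(\<integral>x. (cmod (?d x))\<^sup>2 \<partial>M) = 0"
    by (simp only: integral_complex_of_real of_real_eq_0_iff)
  then have "AE x in M. (cmod (?d x))\<^sup>2 = 0"
    using d by (subst (asm) integral_nonneg_eq_0_iff_AE) (auto simp: L2_def)
  then show ?thesis by eventually_elim simp
qed

end

locale order_unitary = unitary_operator +
  assumes order: "\<And>h. h \<in> L2 M \<Longrightarrow> (AE x in M. V h x \<in> \<real>\<^sub>\<ge>\<^sub>0) \<longleftrightarrow> (AE x in M. h x \<in> \<real>\<^sub>\<ge>\<^sub>0)"

text \<open>The weight replaces the constant 1: the functions \<open>w 1_E\<close> represent
  measurable sets inside \<open>L2 M\<close> even when the measure is infinite.\<close>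

locale weighted_order_unitary = order_unitary +
  fixes w :: "'a \<Rightarrow> complex"
  assumes w_L2: "w \<in> L2 M" and w_nonneg: "\<And>x. w x \<in> \<real>\<^sub>\<ge>\<^sub>0" and w_nonzero: "\<And>x. w x \<noteq> 0"
begin

definition v :: "'a \<Rightarrow> complex" where "v = V w"

lemma v_L2: "v \<in> L2 M"
  unfolding v_def by (rule V_L2[OF w_L2])

lemma v_nonneg: "AE x in M. v x \<in> \<real>\<^sub>\<ge>\<^sub>0"
  unfolding v_def using order[OF w_L2] w_nonneg by simp

text \<open>If \<open>v\<close> vanishes on \<open>Z\<close>, the preimage \<open>h\<close> of
  \<open>w 1_Z\<close> is nonnegative and orthogonal to the nowhere vanishing \<open>w\<close>.
  Hence \<open>h\<close> is zero, so is \<open>w 1_Z\<close>, and \<open>Z\<close> is null.\<close>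

lemma v_nonzero: "AE x in M. v x \<noteq> 0"
proof -
  define Z where "Z = {x \<in> space M. v x = 0}"
  have [measurable]: "v \<in> borel_measurable M" by (rule L2_measurable[OF v_L2])
  have [measurable]: "Z \<in> sets M" unfolding Z_def by measurable
  let ?u = "\<lambda>x. w x * indicator Z x"
  have u: "?u \<in> L2 M" by (intro L2_indicator_mult w_L2) simp
  then obtain h where h: "h \<in> L2 M" "AE x in M. V h x = ?u x" using V_surj by metis
  have "AE x in M. V h x \<in> \<real>\<^sub>\<ge>\<^sub>0"
    using h(2) by eventually_elim (simp add: w_nonneg split: split_indicator)
  then have "AE x in M. h x \<in> \<real>\<^sub>\<ge>\<^sub>0" using order[OF h(1)] by simp
  moreover have "l2_inner M h w = 0"
  proof -
    have "l2_inner M h w = l2_inner M (V h) v" using V_inner[OF h(1) w_L2] by (simp add: v_def)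
    also have "\<dots> = l2_inner M ?u v"
      by (rule l2_inner_cong_AE) (auto intro: V_L2 h u v_L2)
    also have "\<dots> = (\<integral>x. 0 \<partial>M)"
      unfolding l2_inner_def
      by (intro Bochner_Integration.integral_cong) (auto simp: Z_def split: split_indicator)
    finally show ?thesis by simp
  qed
  ultimately have "AE x in M. h x = 0 \<or> w x = 0"
    using nonneg_orthogonal_imp_disjoint[OF h(1) w_L2] w_nonneg by simp
  then have "AE x in M. h x = 0" using w_nonzero by simp
  then have "AE x in M. V h x = V (\<lambda>_. 0) x" by (intro V_cong h(1) L2_zero)
  with V_zero h(2) AE_space show ?thesis
    by eventually_elim (auto simp: Z_def w_nonzero split: split_indicator_asm)
qed

definition corr :: "'a set \<Rightarrow> 'a set \<Rightarrow> bool" where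
  "corr E F \<longleftrightarrow> (AE x in M. V (\<lambda>x. w x * indicator E x) x = v x * indicator F x)"

text \<open>The orthogonal splitting of \<open>w\<close> along \<open>E\<close> goes to an
  orthogonal nonnegative splitting of \<open>v\<close>. Disjoint summands of \<open>v\<close> are
  restrictions of \<open>v\<close> to their supports.\<close>

lemma corr_total_right:
  assumes [measurable]: "E \<in> sets M"
  shows "\<exists>F\<in>sets M. corr E F"
proof -
  let ?a = "\<lambda>x. w x * indicator E x" and ?b = "\<lambda>x. w x * indicator (space M - E) x"
  have L: "?a \<in> L2 M" "?b \<in> L2 M" by (auto intro: L2_indicator_mult w_L2)
  have nonneg: "AE x in M. V ?a x \<in> \<real>\<^sub>\<ge>\<^sub>0" "AE x in M. V ?b x \<in> \<real>\<^sub>\<ge>\<^sub>0"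
    using order[OF L(1)] order[OF L(2)] w_nonneg by (auto split: split_indicator)
  have "l2_inner M ?a ?b = (\<integral>x. 0 \<partial>M)"
    unfolding l2_inner_def by (intro Bochner_Integration.integral_cong) (auto split: split_indicator)
  then have disj: "AE x in M. V ?a x = 0 \<or> V ?b x = 0"
    using nonneg_orthogonal_imp_disjoint[OF V_L2[OF L(1)] V_L2[OF L(2)] nonneg] V_inner[OF L] by simp
  have "AE x in M. V (\<lambda>x. ?a x + ?b x) x = v x"
    unfolding v_def using AE_space
    by (intro V_cong L2_add L w_L2) (auto elim!: eventually_mono split: split_indicator)
  then have "AE x in M. V ?a x + V ?b x = v x"
    using V_add[OF L] by eventually_elim simp
  then have "corr E {x \<in> space M. V ?a x \<noteq> 0}"
    unfolding corr_def using disj by (rule disjoint_summand_eq_indicator)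
  moreover have "{x \<in> space M. V ?a x \<noteq> 0} \<in> sets M"
    using L2_measurable[OF V_L2[OF L(1)]] by measurable
  ultimately show ?thesis by blast
qed

text \<open>The same splitting argument for the inverse of \<open>V\<close>; injectivity identifies
  the sum of the two preimages with \<open>w\<close>.\<close>

lemma corr_total_left:
  assumes [measurable]: "F \<in> sets M"
  shows "\<exists>E\<in>sets M. corr E F"
proof -
  let ?c = "\<lambda>x. v x * indicator F x" and ?d = "\<lambda>x. v x * indicator (space M - F) x"
  have L: "?c \<in> L2 M" "?d \<in> L2 M" by (auto intro: L2_indicator_mult v_L2)
  obtain a where a: "a \<in> L2 M" "AE x in M. V a x = ?c x" using V_surj[OF L(1)] by blast
  obtain b where b: "b \<in> L2 M" "AE x in M. V b x = ?d x" using V_surj[OF L(2)] by blast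
  have "AE x in M. V a x \<in> \<real>\<^sub>\<ge>\<^sub>0"
    using a(2) v_nonneg by eventually_elim (simp split: split_indicator)
  then have a0: "AE x in M. a x \<in> \<real>\<^sub>\<ge>\<^sub>0" using order[OF a(1)] by simp
  have "AE x in M. V b x \<in> \<real>\<^sub>\<ge>\<^sub>0"
    using b(2) v_nonneg by eventually_elim (simp split: split_indicator)
  then have b0: "AE x in M. b x \<in> \<real>\<^sub>\<ge>\<^sub>0" using order[OF b(1)] by simp
  have "l2_inner M a b = l2_inner M (V a) (V b)" using V_inner[OF a(1) b(1)] by simp
  also have "\<dots> = l2_inner M ?c ?d"
    by (rule l2_inner_cong_AE) (auto intro: V_L2 a b L)
  also have "\<dots> = (\<integral>x. 0 \<partial>M)"
    unfolding l2_inner_def by (intro Bochner_Integration.integral_cong) (auto split: split_indicator)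
  finally have disj: "AE x in M. a x = 0 \<or> b x = 0"
    using nonneg_orthogonal_imp_disjoint[OF a(1) b(1) a0 b0] by simp
  have "AE x in M. V (\<lambda>x. a x + b x) x = V w x"
    using V_add[OF a(1) b(1)] a(2) b(2) AE_space
  proof eventually_elim
    case (elim x)
    then show ?case by (cases "x \<in> F") (simp_all add: v_def)
  qed
  then have "AE x in M. a x + b x = w x" by (rule V_inj[OF L2_add[OF a(1) b(1)] w_L2])
  then have eq: "AE x in M. a x = w x * indicator {x \<in> space M. a x \<noteq> 0} x"
    using disj by (rule disjoint_summand_eq_indicator)
  have E: "{x \<in> space M. a x \<noteq> 0} \<in> sets M"
    using L2_measurable[OF a(1)] by measurable
  have "AE x in M. V a x = V (\<lambda>x. w x * indicator {x \<in> space M. a x \<noteq> 0} x) x"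
    by (intro V_cong a(1) L2_indicator_mult w_L2 E eq)
  then have "corr {x \<in> space M. a x \<noteq> 0} F"
    unfolding corr_def using a(2) by eventually_elim simp
  then show ?thesis using E by blast
qed

text \<open>Inclusion modulo null sets is nonnegativity of \<open>w 1_E' - w 1_E\<close>, which
  \<open>V\<close> preserves and reflects. Uniqueness of partners and invariance of null sets follow
  from it.\<close>

lemma corr_subset_iff:
  assumes [measurable]: "E \<in> sets M" "E' \<in> sets M" and "corr E F" "corr E' F'"
  shows "(AE x in M. x \<in> E \<longrightarrow> x \<in> E') \<longleftrightarrow> (AE x in M. x \<in> F \<longrightarrow> x \<in> F')"
proof -
  let ?a = "\<lambda>x. w x * indicator E x" and ?b = "\<lambda>x. w x * indicator E' x"
  have L: "?a \<in> L2 M" "?b \<in> L2 M" by (auto intro: L2_indicator_mult w_L2)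
  have neg: "- z \<in> \<real>\<^sub>\<ge>\<^sub>0 \<longleftrightarrow> z = 0" if "z \<in> \<real>\<^sub>\<ge>\<^sub>0" for z :: complex
    using that by (auto simp: complex_nonneg_Reals_iff complex_eq_iff)
  have "(AE x in M. x \<in> E \<longrightarrow> x \<in> E') \<longleftrightarrow> (AE x in M. ?b x - ?a x \<in> \<real>\<^sub>\<ge>\<^sub>0)"
    using neg[OF w_nonneg] w_nonneg w_nonzero by (intro AE_cong) (auto split: split_indicator)
  also have "\<dots> \<longleftrightarrow> (AE x in M. V (\<lambda>x. ?b x - ?a x) x \<in> \<real>\<^sub>\<ge>\<^sub>0)"
    using order[OF L2_diff[OF L(2,1)]] by simp
  also have "\<dots> \<longleftrightarrow> (AE x in M. x \<in> F \<longrightarrow> x \<in> F')"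
  proof -
    have "AE x in M. V (\<lambda>x. ?b x - ?a x) x \<in> \<real>\<^sub>\<ge>\<^sub>0 \<longleftrightarrow> (x \<in> F \<longrightarrow> x \<in> F')"
      using V_diff[OF L(2,1)] assms(3,4)[unfolded corr_def] v_nonneg v_nonzero
    proof eventually_elim
      case (elim x)
      then show ?case using neg[of "v x"] by (auto split: split_indicator)
    qed
    then show ?thesis by (rule eventually_subst)
  qed
  finally show ?thesis .
qed

lemma corr_cong_right:
  assumes "corr E F" "AE x in M. x \<in> F \<longleftrightarrow> x \<in> F'"
  shows "corr E F'"
  using assms unfolding corr_def by eventually_elim (auto split: split_indicator)

lemma corr_unique:
  assumes "E \<in> sets M" "E' \<in> sets M" "corr E F" "corr E' F'"
  shows "(AE x in M. x \<in> E \<longleftrightarrow> x \<in> E') \<longleftrightarrow> (AE x in M. x \<in> F \<longleftrightarrow> x \<in> F')"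
  using corr_subset_iff[OF assms] corr_subset_iff[OF assms(2,1,4,3)]
  by (simp add: iff_conv_conj_imp)

lemma corr_empty: "corr {} {}"
  using V_zero by (simp add: corr_def)

lemma corr_null_iff:
  assumes "E \<in> sets M" "F \<in> sets M" "corr E F"
  shows "emeasure M E = 0 \<longleftrightarrow> emeasure M F = 0"
proof -
  have "emeasure M A = 0 \<longleftrightarrow> (AE x in M. x \<in> A \<longleftrightarrow> x \<in> {})" if "A \<in> sets M" for A
    using AE_iff_null_sets[OF that] that by (simp add: null_sets_def)
  then show ?thesis using corr_unique[OF assms(1) _ assms(3) corr_empty] assms by auto
qed

lemma corr_compl:
  assumes [measurable]: "E \<in> sets M" and "corr E F"
  shows "corr (space M - E) (space M - F)"
proof -
  let ?a = "\<lambda>x. w x * indicator E x" and ?b = "\<lambda>x. w x * indicator (space M - E) x"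
  have L: "?a \<in> L2 M" "?b \<in> L2 M" by (auto intro: L2_indicator_mult w_L2)
  have "AE x in M. V ?b x = V (\<lambda>x. w x - ?a x) x"
    using AE_space by (intro V_cong L2_diff L w_L2) (auto elim!: eventually_mono split: split_indicator)
  then show ?thesis
    using V_diff[OF w_L2 L(1)] assms(2) AE_space unfolding corr_def
    by eventually_elim (auto simp: v_def split: split_indicator)
qed

text \<open>An order isomorphism preserves suprema, so no continuity of \<open>V\<close> is needed here.\<close>

lemma corr_UN:
  fixes E F :: "nat \<Rightarrow> 'a set"
  assumes E: "range E \<subseteq> sets M" and F: "range F \<subseteq> sets M" and R: "\<And>n. corr (E n) (F n)"
  shows "corr (\<Union>n. E n) (\<Union>n. F n)"
proof -
  have [measurable]: "E n \<in> sets M" "F n \<in> sets M" for n using E F by auto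
  have sets: "(\<Union>n. E n) \<in> sets M" "(\<Union>n. F n) \<in> sets M" by measurable
  obtain F' where F': "F' \<in> sets M" "corr (\<Union>n. E n) F'"
    using corr_total_right[OF sets(1)] by metis
  obtain E' where E': "E' \<in> sets M" "corr E' (\<Union>n. F n)"
    using corr_total_left[OF sets(2)] by metis
  have "AE x in M. x \<in> F n \<longrightarrow> x \<in> F'" for n
    using corr_subset_iff[OF _ sets(1) R F'(2), of n] by auto
  then have "AE x in M. \<forall>n. x \<in> F n \<longrightarrow> x \<in> F'" by (subst AE_all_countable) blast
  then have 1: "AE x in M. x \<in> (\<Union>n. F n) \<longrightarrow> x \<in> F'" by eventually_elim blast
  have "AE x in M. x \<in> E n \<longrightarrow> x \<in> E'" for n
    using corr_subset_iff[OF _ E'(1) R E'(2), of n] by auto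
  then have "AE x in M. \<forall>n. x \<in> E n \<longrightarrow> x \<in> E'" by (subst AE_all_countable) blast
  then have "AE x in M. x \<in> (\<Union>n. E n) \<longrightarrow> x \<in> E'" by eventually_elim blast
  then have 2: "AE x in M. x \<in> F' \<longrightarrow> x \<in> (\<Union>n. F n)"
    using corr_subset_iff[OF sets(1) E'(1) F'(2) E'(2)] by simp
  show ?thesis
    using F'(2) by (rule corr_cong_right) (use 1 2 in eventually_elim, blast)
qed

lemma corr_automorphism:
  assumes sb: "standard_borel M" and na: "non_atomic M" and pos: "emeasure M (space M) \<noteq> 0"
  obtains S where "nonsingular_aut M S"
    "\<And>E. E \<in> sets M \<Longrightarrow> corr E (inv_into (space M) S -` E \<inter> space M)"
proof -
  have ne: "space M \<noteq> {}" using pos by auto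
  have "\<exists>T. T \<in> M \<rightarrow>\<^sub>M M \<and> (\<forall>E\<in>sets M. corr E (T -` E \<inter> space M))"
  proof (rule set_correspondence_realization[OF sb ne, of corr])
    show "corr (\<Union>n. E n) (\<Union>n. F n)"
      if "range E \<subseteq> sets M" "range F \<subseteq> sets M" "\<And>n. corr (E n) (F n)" for E F :: "nat \<Rightarrow> 'a set"
      using that by (rule corr_UN)
  qed (auto intro: corr_total_right corr_empty corr_compl)
  then obtain T where T: "T \<in> M \<rightarrow>\<^sub>M M" "\<And>E. E \<in> sets M \<Longrightarrow> corr E (T -` E \<inter> space M)"
    by blast
  have "\<exists>T. T \<in> M \<rightarrow>\<^sub>M M \<and> (\<forall>E\<in>sets M. corr (T -` E \<inter> space M) E)"
  proof (rule set_correspondence_realization[OF sb ne, of "\<lambda>E F. corr F E"])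
    show "corr (\<Union>n. F n) (\<Union>n. E n)"
      if "range E \<subseteq> sets M" "range F \<subseteq> sets M" "\<And>n. corr (F n) (E n)" for E F :: "nat \<Rightarrow> 'a set"
      using that(2,1,3) by (rule corr_UN)
  qed (auto intro: corr_total_left corr_empty corr_compl)
  then obtain T' where T': "T' \<in> M \<rightarrow>\<^sub>M M" "\<And>E. E \<in> sets M \<Longrightarrow> corr (T' -` E \<inter> space M) E"
    by blast
  have TM: "T x \<in> space M" "T' x \<in> space M" if "x \<in> space M" for x
    using that measurable_space[OF T(1)] measurable_space[OF T'(1)] by auto
  have TT': "AE x in M. T (T' x) = x"
  proof (rule AE_fixes_sets_imp_AE_id[OF sb measurable_compose[OF T'(1) T(1)]])
    fix E assume E: "E \<in> sets M"
    have s: "T -` E \<inter> space M \<in> sets M" using measurable_sets[OF T(1) E] .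
    then have s': "T' -` (T -` E \<inter> space M) \<inter> space M \<in> sets M" by (rule measurable_sets[OF T'(1)])
    have "AE x in M. x \<in> E \<longleftrightarrow> x \<in> T' -` (T -` E \<inter> space M) \<inter> space M"
      \<comment> \<open>Both sets are partners of the preimage of \<open>E\<close> under
        \<open>T\<close>, hence equal modulo null sets.\<close>
      using corr_unique[OF E s' T(2)[OF E] T'(2)[OF s]] by simp
    then show "AE x in M. x \<in> E \<longleftrightarrow> T (T' x) \<in> E"
      using AE_space by eventually_elim (auto simp: TM)
  qed
  have T'T: "AE x in M. T' (T x) = x"
  proof (rule AE_fixes_sets_imp_AE_id[OF sb measurable_compose[OF T(1) T'(1)]])
    fix E assume E: "E \<in> sets M"
    have s: "T' -` E \<inter> space M \<in> sets M" using measurable_sets[OF T'(1) E] .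
    have "AE x in M. x \<in> E \<longleftrightarrow> x \<in> T -` (T' -` E \<inter> space M) \<inter> space M"
      using corr_unique[OF s s T'(2)[OF E] T(2)[OF s]] by simp
    then show "AE x in M. x \<in> E \<longleftrightarrow> T' (T x) \<in> E"
      using AE_space by eventually_elim (auto simp: TM)
  qed
  have null: "T -` N \<inter> space M \<in> null_sets M" if "N \<in> null_sets M" for N
    using corr_null_iff[OF _ _ T(2), of N] that measurable_sets[OF T(1), of N] by (auto simp: null_sets_def)
  obtain h k where hk: "h \<in> M \<rightarrow>\<^sub>M M" "k \<in> M \<rightarrow>\<^sub>M M" "\<And>x. x \<in> space M \<Longrightarrow> k (h x) = x"
      "\<And>x. x \<in> space M \<Longrightarrow> h (k x) = x" and hT: "AE x in M. h x = T x"
    by (rule AE_inverse_imp_automorphism[OF sb sigma_finite_measure_axioms na pos T(1) T'(1) T'T TT' null])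
      (assumption | rule that)+
  have hM: "h x \<in> space M" "k x \<in> space M" if "x \<in> space M" for x
    using that measurable_space[OF hk(1)] measurable_space[OF hk(2)] by auto
  have bij: "bij_betw k (space M) (space M)"
    using hk(3,4) hM by (intro bij_betw_byWitness[of _ h]) auto
  have inv: "inv_into (space M) k x = h x" if "x \<in> space M" for x
    using bij hk(3) hM that by (intro inv_into_f_eq) (auto simp: bij_betw_def)
  have corr_h: "corr E (h -` E \<inter> space M)" if "E \<in> sets M" for E
    using T(2)[OF that] by (rule corr_cong_right) (use hT AE_space in eventually_elim, auto)
  have "emeasure M (k -` A \<inter> space M) = 0 \<longleftrightarrow> emeasure M A = 0" if A: "A \<in> sets M" for A
  proof -
    have s: "k -` A \<inter> space M \<in> sets M" using measurable_sets[OF hk(2) A] .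
    have "h -` (k -` A \<inter> space M) \<inter> space M = A"
      using sets.sets_into_space[OF A] hM hk(3) by auto
    then show ?thesis using corr_null_iff[OF s A] corr_h[OF s] by simp
  qed
  moreover have "inv_into (space M) k \<in> M \<rightarrow>\<^sub>M M"
    using hk(1) inv by (simp cong: measurable_cong)
  \<comment> \<open>The automorphism is \<open>k\<close>, not \<open>h\<close>: the realized map is
    the one composed with functions in \<open>U_op\<close>, that is, the inverse of
    \<open>S\<close>.\<close>
  ultimately have "nonsingular_aut M k" using bij hk(2) by (simp add: nonsingular_aut_def)
  moreover have "inv_into (space M) k -` E \<inter> space M = h -` E \<inter> space M" for E
    using inv by auto
  ultimately show ?thesis using that corr_h by simp
qed

text \<open>Two functions with equal integrals over all measurable sets agree, so it is enough to
  pair with \<open>w 1_E\<close>. Both operators send these functions to restrictions to the same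
  set, and both preserve inner products; no approximation by simple functions is involved.\<close>

lemma U_op_eq:
  assumes aut: "nonsingular_aut M S"
    and corr: "\<And>E. E \<in> sets M \<Longrightarrow> corr E (inv_into (space M) S -` E \<inter> space M)"
    and h: "h \<in> L2 M"
  shows "AE x in M. V h x = U_op M S h x"
proof -
  interpret S: nonsingular_automorphism M S
    using aut by unfold_locales
  let ?U = "U_op M S"
  have UL2: "?U f \<in> L2 M" if "f \<in> L2 M" for f using that by (simp add: S.U_op_L2_iff L2_measurable)
  define E where "E G = S -` G \<inter> space M" for G
  have E [measurable]: "E G \<in> sets M" if "G \<in> sets M" for G
    unfolding E_def using measurable_sets[OF S.measurable_S that] .
  have TE: "inv_into (space M) S -` E G \<inter> space M = G" if "G \<in> sets M" for G
    using sets.sets_into_space[OF that] S.T_space by (auto simp: E_def subset_iff)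
  have U_ind: "AE x in M. ?U (\<lambda>x. w x * indicator (E G) x) x = ?U w x * indicator G x" if "G \<in> sets M" for G
    using AE_space
  proof eventually_elim
    case (elim x)
    have "inv_into (space M) S x \<in> E G \<longleftrightarrow> x \<in> G" using TE[OF that] elim by blast
    then show ?case by (simp add: U_op_def indicator_def)
  qed
  have V_ind: "AE x in M. V (\<lambda>x. w x * indicator (E G) x) x = v x * indicator G x" if "G \<in> sets M" for G
    using corr[OF E[OF that]] TE[OF that] by (simp add: corr_def)
  have wE: "(\<lambda>x. w x * indicator (E G) x) \<in> L2 M" if "G \<in> sets M" for G
    using that by (intro L2_indicator_mult w_L2 E)
  \<comment> \<open>Over each \<open>G\<close> both integrals are the squared norm of
    \<open>w 1_E\<close>, with \<open>E\<close> the preimage of \<open>G\<close> under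
    \<open>S\<close>. Nonnegativity then gives equality without squares.\<close>
  have "AE x in M. cnj (v x) * v x = cnj (?U w x) * ?U w x"
  proof (rule density_unique_banach)
    fix G assume G: "G \<in> sets M"
    have "(LINT x:G|M. cnj (v x) * v x) = l2_inner M (\<lambda>x. v x * indicator G x) (\<lambda>x. v x * indicator G x)"
      unfolding set_lebesgue_integral_def l2_inner_def
      by (intro Bochner_Integration.integral_cong) (auto split: split_indicator)
    also have "\<dots> = l2_inner M (V (\<lambda>x. w x * indicator (E G) x)) (V (\<lambda>x. w x * indicator (E G) x))"
      using V_ind[OF G] by (intro l2_inner_cong_AE L2_indicator_mult v_L2 V_L2 wE G) (auto elim!: eventually_mono)
    also have "\<dots> = l2_inner M (?U (\<lambda>x. w x * indicator (E G) x)) (?U (\<lambda>x. w x * indicator (E G) x))"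
      using V_inner[OF wE[OF G] wE[OF G]] S.U_op_inner[OF wE[OF G] wE[OF G]] by simp
    also have "\<dots> = l2_inner M (\<lambda>x. ?U w x * indicator G x) (\<lambda>x. ?U w x * indicator G x)"
      using U_ind[OF G] by (intro l2_inner_cong_AE L2_indicator_mult UL2 w_L2 wE G)
    also have "\<dots> = (LINT x:G|M. cnj (?U w x) * ?U w x)"
      unfolding set_lebesgue_integral_def l2_inner_def
      by (intro Bochner_Integration.integral_cong) (auto split: split_indicator)
    finally show "(LINT x:G|M. cnj (v x) * v x) = (LINT x:G|M. cnj (?U w x) * ?U w x)" .
  qed (intro integrable_cnj_mult v_L2 UL2 w_L2)+
  then have vU: "AE x in M. v x = ?U w x"
    using v_nonneg
  proof eventually_elim
    case (elim x)
    obtain a where a: "v x = complex_of_real a" "a \<ge> 0" using elim(2) by (auto elim: nonneg_Reals_cases)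
    have "w (inv_into (space M) S x) \<in> \<real>\<^sub>\<ge>\<^sub>0" by (rule w_nonneg)
    then have "?U w x \<in> \<real>\<^sub>\<ge>\<^sub>0" unfolding U_op_def by (intro nonneg_Reals_mult_I) auto
    then obtain b where b: "?U w x = complex_of_real b" "b \<ge> 0" by (auto elim: nonneg_Reals_cases)
    have "a * a = b * b" using elim(1) unfolding a(1) b(1) by (simp flip: of_real_mult)
    then have "a = b" using a(2) b(2) by (metis abs_of_nonneg real_sqrt_abs2)
    then show ?case by (simp add: a b)
  qed
  \<comment> \<open>Testing against \<open>v 1_G\<close>, the common image of \<open>w 1_E\<close>
    under both operators; the nonvanishing factor \<open>v\<close> cancels at the end.\<close>
  have "AE x in M. cnj (v x) * V h x = cnj (v x) * ?U h x"
  proof (rule density_unique_banach)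
    fix G assume G: "G \<in> sets M"
    have "(LINT x:G|M. cnj (v x) * V h x) = l2_inner M (\<lambda>x. v x * indicator G x) (V h)"
      unfolding set_lebesgue_integral_def l2_inner_def
      by (intro Bochner_Integration.integral_cong) (auto split: split_indicator)
    also have "\<dots> = l2_inner M (V (\<lambda>x. w x * indicator (E G) x)) (V h)"
      using V_ind[OF G] by (intro l2_inner_cong_AE L2_indicator_mult v_L2 V_L2 wE G h) (auto elim!: eventually_mono)
    also have "\<dots> = l2_inner M (?U (\<lambda>x. w x * indicator (E G) x)) (?U h)"
      using V_inner[OF wE[OF G] h] S.U_op_inner[OF wE[OF G] h] by simp
    also have "\<dots> = l2_inner M (\<lambda>x. v x * indicator G x) (?U h)"
    proof (intro l2_inner_cong_AE L2_indicator_mult UL2 v_L2 w_L2 E G h)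
      show "AE x in M. ?U (\<lambda>x. w x * indicator (E G) x) x = v x * indicator G x"
        using U_ind[OF G] vU by eventually_elim simp
    qed simp
    also have "\<dots> = (LINT x:G|M. cnj (v x) * ?U h x)"
      unfolding set_lebesgue_integral_def l2_inner_def
      by (intro Bochner_Integration.integral_cong) (auto split: split_indicator)
    finally show "(LINT x:G|M. cnj (v x) * V h x) = (LINT x:G|M. cnj (v x) * ?U h x)" .
  qed (intro integrable_cnj_mult v_L2 V_L2 UL2 h)+
  then show ?thesis using v_nonzero by eventually_elim simp
qed

end

lemma (in order_unitary) order_unitary_eq_U_op:
  assumes sb: "standard_borel M" and na: "non_atomic M" and pos: "emeasure M (space M) \<noteq> 0"
  obtains S where "nonsingular_aut M S" "\<And>h. h \<in> L2 M \<Longrightarrow> AE x in M. V h x = U_op M S h x"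
proof -
  obtain w0 :: "'a \<Rightarrow> real" where w0: "w0 \<in> borel_measurable M" "\<And>x. 0 < w0 x" "\<And>x. w0 x \<le> 1" "integrable M w0"
    using obtain_positive_integrable_function by metis
  \<comment> \<open>The upper bound 1 turns an integrable weight into a square integrable
    one.\<close>
  have sq: "(w0 x)\<^sup>2 \<le> w0 x" for x
    using w0(2,3)[of x] by (simp add: power2_eq_square mult_left_le)
  have "integrable M (\<lambda>x. (w0 x)\<^sup>2)"
    using w0(4) by (rule Bochner_Integration.integrable_bound) (use w0(1,2) sq in \<open>auto intro!: AE_I2 simp: less_imp_le\<close>)
  then have "(\<lambda>x. complex_of_real (w0 x)) \<in> L2 M" using w0(1) by (simp add: L2_def)
  then interpret weighted_order_unitary M V "\<lambda>x. complex_of_real (w0 x)"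
    by unfold_locales (auto simp: less_imp_le[OF w0(2)] less_imp_neq[OF w0(2), symmetric])
  obtain S where S: "nonsingular_aut M S" "\<And>E. E \<in> sets M \<Longrightarrow> corr E (inv_into (space M) S -` E \<inter> space M)"
    using corr_automorphism[OF sb na pos] by metis
  show ?thesis
    by (rule that[OF S(1)]) (rule U_op_eq[OF S])
qed

section \<open>Affine maps preserving the cone\<close>

text \<open>Pointwise form of the fact that the directions in which \<open>C_minus1\<close> is
  unbounded are the nonnegative ones.\<close>

lemma nonneg_Reals_if_multiples_bounded_below:
  assumes "c \<in> \<real>" "\<And>n :: nat. c + of_nat n * z \<in> \<real> \<and> -1 \<le> Re (c + of_nat n * z)"
  shows "z \<in> \<real>\<^sub>\<ge>\<^sub>0"
proof -
  have "z \<in> \<real>" using assms(1) assms(2)[of 1] by (simp add: complex_is_Real_iff)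
  moreover have "0 \<le> Re z"
  proof (rule ccontr)
    assume "\<not> 0 \<le> Re z"
    then have neg: "- Re z > 0" by simp
    then obtain n :: nat where "1 + Re c < of_nat n * (- Re z)" using reals_Archimedean3 by blast
    then show False using assms(2)[of n] by simp
  qed
  ultimately show ?thesis by (simp add: complex_nonneg_Reals_iff complex_is_Real_iff)
qed

lemma affine_C_minus1_order_unitary:
  assumes sf: "sigma_finite_measure M" and A: "(f, V) \<in> Aff_R M" and pres: "aff_preserves M (f, V) (C_minus1 M)"
  shows "order_unitary M V"
proof -
  have f: "f \<in> L2 M" "AE x in M. f x \<in> \<real>" and VR: "unitary_R M V"
    using A by (auto simp: Aff_R_def L2R_def)
  interpret unitary_operator M V
    using sf VR by (simp add: unitary_operator_def unitary_operator_axioms_def unitary_R_def)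
  have into: "aff_apply (f, V) h \<in> C_minus1 M" if "h \<in> C_minus1 M" for h
    using pres that by (simp add: aff_preserves_def)
  have onto: "\<exists>h\<in>C_minus1 M. ae_eq M (aff_apply (f, V) h) g" if "g \<in> C_minus1 M" for g
    using pres that by (simp add: aff_preserves_def)
  have mult: "(\<lambda>x. of_nat n * h x) \<in> C_minus1 M" if "h \<in> L2 M" "AE x in M. h x \<in> \<real>\<^sub>\<ge>\<^sub>0" for h and n :: nat
  proof -
    have "AE x in M. of_nat n * h x \<in> \<real> \<and> -1 \<le> Re (of_nat n * h x)"
      using that(2)
    proof eventually_elim
      case (elim x)
      then have "0 \<le> real n * Re (h x)" by (simp add: complex_nonneg_Reals_iff)
      then have "-1 \<le> real n * Re (h x)" by linarith
      then show ?case using elim by (simp add: complex_nonneg_Reals_iff complex_is_Real_iff)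
    qed
    then show ?thesis using L2_cmult[OF that(1)] by (simp add: C_minus1_def)
  qed
  \<comment> \<open>The inverse affine map is the inverse of \<open>V\<close> followed by
    translation by \<open>- f0\<close>, so \<open>- f0\<close> takes the role of \<open>f\<close> in
    the converse direction.\<close>
  obtain f0 where "f0 \<in> L2R M" "ae_eq M (V f0) f"
    using VR A by (auto simp: unitary_R_def Aff_R_def)
  then have f0: "f0 \<in> L2 M" "AE x in M. f0 x \<in> \<real>" "AE x in M. V f0 x = f x"
    by (simp_all add: L2R_def ae_eq_def)
  show ?thesis
  proof unfold_locales
    fix h assume h: "h \<in> L2 M"
    show "(AE x in M. V h x \<in> \<real>\<^sub>\<ge>\<^sub>0) \<longleftrightarrow> (AE x in M. h x \<in> \<real>\<^sub>\<ge>\<^sub>0)"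
    proof
      assume pos: "AE x in M. h x \<in> \<real>\<^sub>\<ge>\<^sub>0"
      have "AE x in M. f x + of_nat n * V h x \<in> \<real> \<and> -1 \<le> Re (f x + of_nat n * V h x)" for n
      proof -
        have "AE x in M. aff_apply (f, V) (\<lambda>x. of_nat n * h x) x \<in> \<real> \<and>
            -1 \<le> Re (aff_apply (f, V) (\<lambda>x. of_nat n * h x) x)"
          using into[OF mult[OF h pos, of n]] by (simp add: C_minus1_def)
        then show ?thesis using V_cmult[OF h, of "of_nat n"]
          by eventually_elim (simp add: aff_apply_def)
      qed
      then have "AE x in M. \<forall>n. f x + of_nat n * V h x \<in> \<real> \<and> -1 \<le> Re (f x + of_nat n * V h x)"
        by (subst AE_all_countable) blast
      with f(2) show "AE x in M. V h x \<in> \<real>\<^sub>\<ge>\<^sub>0"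
        by eventually_elim (blast intro: nonneg_Reals_if_multiples_bounded_below)
    next
      assume pos: "AE x in M. V h x \<in> \<real>\<^sub>\<ge>\<^sub>0"
      have "AE x in M. - f0 x + of_nat n * h x \<in> \<real> \<and> -1 \<le> Re (- f0 x + of_nat n * h x)" for n
      proof -
        \<comment> \<open>Injectivity of \<open>V\<close> identifies this preimage as
          \<open>n h - f0\<close>, which is therefore bounded below by -1 for every
          \<open>n\<close>.\<close>
        obtain k where k: "k \<in> C_minus1 M" "ae_eq M (aff_apply (f, V) k) (\<lambda>x. of_nat n * V h x)"
          using onto[OF mult[OF V_L2[OF h] pos, of n]] by blast
        then have kL2: "k \<in> L2 M" and kC: "AE x in M. k x \<in> \<real> \<and> -1 \<le> Re (k x)"
          by (simp_all add: C_minus1_def)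
        have "AE x in M. V (\<lambda>x. f0 x + k x) x = V (\<lambda>x. of_nat n * h x) x"
          using V_add[OF f0(1) kL2] V_cmult[OF h, of "of_nat n"] f0(3) k(2)[unfolded ae_eq_def]
          by eventually_elim (simp add: aff_apply_def)
        then have "AE x in M. f0 x + k x = of_nat n * h x"
          by (rule V_inj[OF L2_add[OF f0(1) kL2] L2_cmult[OF h]])
        with kC show ?thesis
        proof eventually_elim
          case (elim x)
          then have "- f0 x + of_nat n * h x = k x" by (metis add_minus_cancel minus_add_cancel)
          then show ?case using elim(1) by simp
        qed
      qed
      then have "AE x in M. \<forall>n. - f0 x + of_nat n * h x \<in> \<real> \<and> -1 \<le> Re (- f0 x + of_nat n * h x)"
        by (subst AE_all_countable) blast
      with f0(2) show "AE x in M. h x \<in> \<real>\<^sub>\<ge>\<^sub>0"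
      proof eventually_elim
        case (elim x)
        show ?case
          by (rule nonneg_Reals_if_multiples_bounded_below[of "- f0 x"]) (use elim in auto)
      qed
    qed
  qed
qed

text \<open>Both inequalities between \<open>f + 1\<close> and \<open>sqrt S'\<close> come from testing on \<open>- 1\<^sub>E\<close> with \<open>E\<close> of finite measure:
  its image lies in \<open>C\<^sub>-\<^sub>1\<close>, and it is itself the image of some \<open>k \<ge> -1\<close>.\<close>

lemma affine_C_minus1_translation:
  assumes sf: "sigma_finite_measure M" and A: "(f, V) \<in> Aff_R M" and pres: "aff_preserves M (f, V) (C_minus1 M)"
    and aut: "nonsingular_aut M S" and VU: "\<And>h. h \<in> L2 M \<Longrightarrow> AE x in M. V h x = U_op M S h x"
  shows "AE x in M. f x = sqrtSp_m1 M S x"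
proof -
  interpret nonsingular_automorphism M S
    using sf aut by (simp add: nonsingular_automorphism_def nonsingular_automorphism_axioms_def)
  have fR: "AE x in M. f x \<in> \<real>" using A by (auto simp: Aff_R_def L2R_def)
  \<comment> \<open>The sets need not increase: each point, and each \<open>T x\<close>, lies in one
    of them, and that one gives the estimate there.\<close>
  obtain E :: "nat \<Rightarrow> 'a set" where E: "range E \<subseteq> sets M" "(\<Union>i. E i) = space M"
      "\<And>i. emeasure M (E i) \<noteq> \<infinity>"
    using sigma_finite by metis
  define g where "g n x = - complex_of_real (indicator (E n) x)" for n x
  have [measurable]: "E n \<in> sets M" for n using E(1) by auto
  have g: "g n \<in> C_minus1 M" for n
  proof -
    have "integrable M (indicator (E n) :: 'a \<Rightarrow> real)"
      using E(3)[of n] by (simp add: less_top)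
    moreover have "(\<lambda>x. (cmod (g n x))\<^sup>2) = indicator (E n)"
      by (auto simp: g_def fun_eq_iff split: split_indicator)
    moreover have "g n \<in> borel_measurable M" unfolding g_def[abs_def] by measurable
    moreover have "g n x \<in> \<real> \<and> -1 \<le> Re (g n x)" for x by (simp add: g_def split: split_indicator)
    ultimately show ?thesis by (simp add: C_minus1_def L2_def)
  qed
  then have gL2: "g n \<in> L2 M" for n by (simp add: C_minus1_def)
  have "AE x in M. sqrt (Sprime M S x) * indicator (E n) (T x) \<le> 1 + Re (f x)" for n
  proof -
    have "aff_apply (f, V) (g n) \<in> C_minus1 M" using pres g by (simp add: aff_preserves_def)
    then have "AE x in M. -1 \<le> Re (f x + V (g n) x)" by (simp add: C_minus1_def aff_apply_def)
    then show ?thesis using VU[OF gL2, of n]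
      by eventually_elim (simp add: U_op_def g_def)
  qed
  then have "AE x in M. \<forall>n. sqrt (Sprime M S x) * indicator (E n) (T x) \<le> 1 + Re (f x)"
    by (subst AE_all_countable) blast
  then have lower: "AE x in M. sqrt (Sprime M S x) \<le> 1 + Re (f x)"
    using AE_space
  proof eventually_elim
    case (elim x)
    then obtain n where "T x \<in> E n" using E(2) T_space by blast
    then show ?case using elim(1)[rule_format, of n] by simp
  qed
  have "AE x in M. x \<in> E n \<longrightarrow> 1 + Re (f x) \<le> sqrt (Sprime M S x)" for n
  proof -
    obtain k where k: "k \<in> C_minus1 M" "ae_eq M (aff_apply (f, V) k) (g n)"
      using pres g unfolding aff_preserves_def by metis
    then have kL2: "k \<in> L2 M" and "AE x in M. k x \<in> \<real> \<and> -1 \<le> Re (k x)" by (simp_all add: C_minus1_def)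
    from AE_T[OF this(2)] k(2)[unfolded ae_eq_def] VU[OF kL2] show ?thesis
    proof eventually_elim
      case (elim x)
      have "Re (f x) + sqrt (Sprime M S x) * Re (k (T x)) = Re (g n x)"
        using arg_cong[OF elim(2), of Re] elim(3) by (simp add: aff_apply_def U_op_def)
      moreover have "sqrt (Sprime M S x) * (-1) \<le> sqrt (Sprime M S x) * Re (k (T x))"
        using elim(1) by (intro mult_left_mono) auto
      ultimately show ?case by (auto simp: g_def)
    qed
  qed
  then have "AE x in M. \<forall>n. x \<in> E n \<longrightarrow> 1 + Re (f x) \<le> sqrt (Sprime M S x)"
    by (subst AE_all_countable) blast
  with lower fR AE_space show ?thesis
  proof eventually_elim
    case (elim x)
    then obtain n where "x \<in> E n" using E(2) by blast
    then have "Re (f x) = sqrt (Sprime M S x) - 1" using elim(1,4) by force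
    then show ?case using elim(2) by (simp add: sqrtSp_m1_def complex_is_Real_iff complex_eq_iff)
  qed
qed

lemma nonsingular_aut_id: "nonsingular_aut M (\<lambda>x. x)"
proof -
  have "inv_into (space M) (\<lambda>x. x) x = x" if "x \<in> space M" for x
    using inv_into_f_f[of "\<lambda>x. x" "space M" x] that by simp
  then have "inv_into (space M) (\<lambda>x. x) \<in> M \<rightarrow>\<^sub>M M" by (simp cong: measurable_cong)
  moreover have "(\<lambda>x. x) -` A \<inter> space M = A" if "A \<in> sets M" for A
    using sets.sets_into_space[OF that] by auto
  ultimately show ?thesis by (simp add: nonsingular_aut_def bij_betw_def)
qed

lemma affine_C_minus1_automorphism:
  assumes M: "standard_sf_na M" and A: "A \<in> Aff_R M" and pres: "aff_preserves M A (C_minus1 M)"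
  shows "\<exists>S\<in>Aut2 M. ae_eq M (fst A) (sqrtSp_m1 M S) \<and> (\<forall>h\<in>L2 M. ae_eq M (snd A h) (U_op M S h))"
proof -
  obtain f V where fV: "A = (f, V)" by (cases A)
  have sb: "standard_borel M" and sf: "sigma_finite_measure M" and na: "non_atomic M"
    using M by (auto simp: standard_sf_na_def)
  have AfV: "(f, V) \<in> Aff_R M" and presfV: "aff_preserves M (f, V) (C_minus1 M)"
    using A pres fV by auto
  interpret order_unitary M V
    by (rule affine_C_minus1_order_unitary[OF sf AfV presfV])
  have "\<exists>S. nonsingular_aut M S \<and> (\<forall>h\<in>L2 M. AE x in M. V h x = U_op M S h x)"
  proof (cases "emeasure M (space M) = 0")
    case True
    then have "AE x in M. P x" for P by (intro AE_I'[of "space M"]) auto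
    then show ?thesis using nonsingular_aut_id by blast
  next
    case False
    then show ?thesis using order_unitary_eq_U_op[OF sb na] by metis
  qed
  then obtain S where S: "nonsingular_aut M S" "\<And>h. h \<in> L2 M \<Longrightarrow> AE x in M. V h x = U_op M S h x"
    by blast
  have f: "AE x in M. f x = sqrtSp_m1 M S x"
    by (rule affine_C_minus1_translation[OF sf AfV presfV S])
  interpret S: nonsingular_automorphism M S using S(1) by unfold_locales
  have "sqrtSp_m1 M S \<in> borel_measurable M" unfolding sqrtSp_m1_def[abs_def] by measurable
  moreover have "f \<in> L2 M" using AfV by (simp add: Aff_R_def L2R_def)
  moreover have "AE x in M. cmod (sqrtSp_m1 M S x) \<le> cmod (f x)" using f by eventually_elim simp
  \<comment> \<open>Square integrability is inherited from the translation part \<open>f\<close>, so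
    membership in \<open>Aut2\<close> comes for free.\<close>
  ultimately have "sqrtSp_m1 M S \<in> L2 M" by (rule L2_bound)
  then have "S \<in> Aut2 M" using S(1) by (simp add: Aut2_def)
  then show ?thesis using f S(2) fV by (auto simp: ae_eq_def)
qed

theorem theorem4p1:
  fixes M :: "'a measure"
  assumes "standard_sf_na M"
  shows "(\<forall>S\<in>Aut2 M. (sqrtSp_m1 M S, U_op M S) \<in> Aff_R M \<and>
            aff_preserves M (sqrtSp_m1 M S, U_op M S) (C_minus1 M))
       \<and> (\<forall>A\<in>Aff_R M. aff_preserves M A (C_minus1 M) \<longrightarrow>
            (\<exists>S\<in>Aut2 M. ae_eq M (fst A) (sqrtSp_m1 M S) \<and>
                         (\<forall>h\<in>L2 M. ae_eq M (snd A h) (U_op M S h))))"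
  using Aut2_preserves[of M] affine_C_minus1_automorphism[OF assms] assms
  by (auto simp: standard_sf_na_def)

end
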